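(* Let $k\in\mathbb N$ and let $\beta(x):=(\beta_0,\beta_1,\ldots,\beta_{2k-2},x,\beta_{2k})$ be a sequence where each $\beta_i$ is a real number, $\beta_0>0$ and $x$ is a variable (in the position of the moment of index $2k-1$). Let $\widehat\beta:=(\beta_0,\ldots,\beta_{2k-4})$ and $\widetilde\beta:=(\beta_0,\ldots,\beta_{2k-2})$ be subsequences of $\beta(x)$, let $v:=(\beta_k\ \cdots\ \beta_{2k-2})$ be a row vector, and let $$\widetilde A:=\begin{pmatrix} A_{\widehat\beta} & v^T\\ v & \beta_{2k}\end{pmatrix}$$ (the objects $\widehat\beta$ and $\widetilde A$ are only used when $k>1$). Then the following statements are equivalent: (1) There exists $x_0\in\mathbb R$ and a representing measure for $\beta(x_0)$ supported on $\mathbb R$. (2) There exists $x_0\in\mathbb R$ and a $(\operatorname{rank}\widetilde\beta)$-atomic representing measure for $\beta(x_0)$. (3) $A_{\beta(x)}$ is partially positive semidefinite and one of the following conditions is true: (a) $k=1$. (b) $k>1$ and one of the following conditions is true: (i) $A_{\widetilde\beta}\succ 0$. (ii) $\operatorname{rank}A_{\widehat\beta}=\operatorname{rank}A_{\widetilde\beta}=\operatorname{rank}\widetilde A$.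
   Context: $\mathbb N$ is the set of positive integers. For a sequence $\gamma=(\gamma_0,\ldots,\gamma_{2m})$ of odd length, $A_\gamma:=(\gamma_{i+j})_{i,j=0}^m$ is the corresponding $(m+1)\times(m+1)$ Hankel matrix (a subsequence is re-indexed from $0$). With columns $\mathbf v_0,\ldots,\mathbf v_m$ of $A_\gamma$, the rank of the sequence is $\operatorname{rank}\gamma:=m+1$ if $A_\gamma$ is nonsingular and $\operatorname{rank}\gamma:=\min\{i:\mathbf v_i\in\operatorname{span}\{\mathbf v_0,\ldots,\mathbf v_{i-1}\}\}$ if $A_\gamma$ is singular (the span of the empty set is $\{0\}$). This is distinguished from the matrix rank $\operatorname{rank}A_\gamma$. A representing measure (supported on $\mathbb R$) for a real sequence $(\beta_0,\ldots,\beta_{2k})$ is a positive Borel measure $\mu$ on $\mathbb R$ with $\beta_i=\int_{\mathbb R}t^i\,d\mu(t)$ for $i=0,\ldots,2k$. A measure is $m$-atomic if it is a sum of $m$ point masses with positive weights at distinct points. A partial symmetric matrix (some symmetric pairs of entries unspecified, here those containing the variable) is partially positive semidefinite if every principal submatrix all of whose entries are specified is positive semidefinite. $A\succ0$ means positive definite, $A\succeq0$ positive semidefinite. *)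

theory Defs
  imports "HOL-Probability.Giry_Monad" "Jordan_Normal_Form.DL_Rank" "Jordan_Normal_Form.DL_Submatrix"
begin

text \<open>A finite sequence \<open>(\<gamma>\<^sub>0, \<dots>, \<gamma>\<^sub>2\<^sub>m)\<close> is given by the number \<open>m\<close> together with a function
  \<open>\<gamma>\<close> on the naturals of which only the values up to \<open>2 * m\<close> are used; an initial
  subsequence is obtained by lowering \<open>m\<close>. The entry type is left open so that \<^term>\<open>None\<close> can
  stand for an unspecified entry.\<close>

definition hankel :: "nat \<Rightarrow> (nat \<Rightarrow> 'a) \<Rightarrow> 'a mat" where
  "hankel m \<gamma> = mat (m + 1) (m + 1) (\<lambda>(i, j). \<gamma> (i + j))"

abbreviation vspan :: "nat \<Rightarrow> real vec set \<Rightarrow> real vec set" where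
  "vspan n S \<equiv> LinearCombinations.module.span class_ring (module_vec TYPE(real) n) S"

abbreviation mat_rank :: "real mat \<Rightarrow> nat" where
  "mat_rank A \<equiv> vec_space.rank (dim_row A) A"

definition seq_rank :: "nat \<Rightarrow> (nat \<Rightarrow> real) \<Rightarrow> nat" where
  "seq_rank m \<gamma> =
    (let A = hankel m \<gamma> in
     if invertible_mat A then m + 1
     else Min {i. i \<le> m \<and> col A i \<in> vspan (m + 1) (col A ` {..<i})})"

definition psd :: "real mat \<Rightarrow> bool" where
  "psd A \<longleftrightarrow> square_mat A \<and> transpose_mat A = A \<and>
     (\<forall>u \<in> carrier_vec (dim_row A). 0 \<le> scalar_prod u (A *\<^sub>v u))"

definition pd :: "real mat \<Rightarrow> bool" where
  "pd A \<longleftrightarrow> square_mat A \<and> transpose_mat A = A \<and>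
     (\<forall>u \<in> carrier_vec (dim_row A). u \<noteq> 0\<^sub>v (dim_row A) \<longrightarrow> 0 < scalar_prod u (A *\<^sub>v u))"

definition partially_psd :: "real option mat \<Rightarrow> bool" where
  "partially_psd A \<longleftrightarrow> square_mat A \<and> transpose_mat A = A \<and>
     (\<forall>I \<subseteq> {..<dim_row A}. (\<forall>i \<in> I. \<forall>j \<in> I. A $$ (i, j) \<noteq> None) \<longrightarrow>
        psd (map_mat the (submatrix A I I)))"

text \<open>Integrability is required explicitly because the Bochner integral of a non-integrable
  function is \<open>0\<close>.\<close>

definition representing_measure :: "nat \<Rightarrow> (nat \<Rightarrow> real) \<Rightarrow> real measure \<Rightarrow> bool" where
  "representing_measure m \<gamma> \<mu> \<longleftrightarrow> sets \<mu> = sets borel \<and>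
     (\<forall>i \<le> 2 * m. integrable \<mu> (\<lambda>t. t ^ i) \<and> \<gamma> i = (\<integral>t. t ^ i \<partial>\<mu>))"

text \<open>\<^term>\<open>return borel a\<close> is the point mass at \<open>a\<close>.\<close>

definition atomic :: "nat \<Rightarrow> real measure \<Rightarrow> bool" where
  "atomic n \<mu> \<longleftrightarrow> sets \<mu> = sets borel \<and>
     (\<exists>S w. finite S \<and> card S = n \<and> (\<forall>a \<in> S. 0 < (w a :: real)) \<and>
        (\<forall>B \<in> sets borel.
           emeasure \<mu> B = (\<Sum>a \<in> S. ennreal (w a) * emeasure (return borel a) B)))"

text \<open>\<open>\<beta>(x\<^sub>0)\<close> with a real number in position \<open>2 * k - 1\<close>, and \<open>\<beta>(x)\<close> with that position left
  unspecified. The value \<open>\<beta> (2 * k - 1)\<close> itself is discarded in both.\<close>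

definition completed :: "nat \<Rightarrow> (nat \<Rightarrow> real) \<Rightarrow> real \<Rightarrow> nat \<Rightarrow> real" where
  "completed k \<beta> x\<^sub>0 = \<beta>(2 * k - 1 := x\<^sub>0)"

definition unspecified :: "nat \<Rightarrow> (nat \<Rightarrow> real) \<Rightarrow> nat \<Rightarrow> real option" where
  "unspecified k \<beta> = (\<lambda>i. Some (\<beta> i))(2 * k - 1 := None)"

definition A_tilde :: "nat \<Rightarrow> (nat \<Rightarrow> real) \<Rightarrow> real mat" where
  "A_tilde k \<beta> =
    (let v = mat_of_row (vec (k - 1) (\<lambda>i. \<beta> (k + i))) in
     four_block_mat (hankel (k - 2) \<beta>) (transpose_mat v) v (mat 1 1 (\<lambda>_. \<beta> (2 * k))))"

end

theory Submission
  imports Defs "HOL-Computational_Algebra.Fundamental_Theorem_Algebra"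
begin

text \<open>
  Read a sequence \<open>\<beta>\<close> as the linear functional \<open>t\<^sup>i \<mapsto> \<beta>\<^sub>i\<close> on polynomials, so that its Hankel matrix is
  the Gram matrix of the monomials. If the functional is positive definite below degree \<open>s\<close> and a
  polynomial of degree \<open>s\<close> is orthogonal to all lower degrees, then this polynomial has \<open>s\<close> simple real
  roots, and Gaussian quadrature at them is an \<open>s\<close>-atomic measure with the same moments as far as the
  orthogonality reaches.

  In the positive definite case the free moment is chosen such that the completed matrix of size
  \<open>k + 1\<close> becomes singular, which provides an orthogonal polynomial of degree \<open>k\<close>. In the singular
  case the first dependent column of the Hankel matrix provides the polynomial, and equality of the
  ranks says that the bordering columns depend on the previous ones, which propagates the agreement of
  the moments up to index \<open>2 k\<close>. Conversely, if a measure is given and the Hankel matrix is singular,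
  a nonzero polynomial vanishes almost everywhere; its multiples of degree \<open>k - 1\<close> and \<open>k\<close> express the
  bordering columns in terms of the others.
\<close>

section \<open>Rank of bordered matrices\<close>

text \<open>Every column of \<open>X * Y\<close> is \<open>X\<close> applied to a column of
  \<open>Y\<close>. The chosen preimages of the vectors of \<open>U\<close> are distinct, and
  \<open>X\<close> carries any linear relation between them to the same relation in
  \<open>U\<close>.\<close>

lemma (in vec_space) lin_indpt_lift_cols:
  assumes X: "X \<in> carrier_mat n m" and Y: "Y \<in> carrier_mat m nc"
    and U: "U \<subseteq> set (cols (X * Y))" "lin_indpt U"
  shows "\<exists>V \<subseteq> set (cols Y). card V = card U \<and> module.lin_indpt class_ring (module_vec TYPE('a) m) V"
proof -
  interpret W: vec_space "TYPE('a)" m .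
  have "\<forall>u \<in> U. \<exists>y \<in> set (cols Y). u = X *\<^sub>v y"
  proof
    fix u assume "u \<in> U"
    then obtain j where "j < nc" "u = col (X * Y) j"
      using U(1) X Y by (auto simp: cols_def)
    then show "\<exists>y \<in> set (cols Y). u = X *\<^sub>v y"
      using X Y by (intro bexI[of _ "col Y j"]) (auto simp: cols_def)
  qed
  then obtain f where f: "\<And>u. u \<in> U \<Longrightarrow> f u \<in> set (cols Y)" "\<And>u. u \<in> U \<Longrightarrow> X *\<^sub>v f u = u"
    by metis
  have "finite U" using U(1) finite_subset by blast
  then obtain us where us: "set us = U" "distinct us" using finite_distinct_list by blast
  have inj: "inj_on f U" by (metis f(2) inj_onI)
  \<comment> \<open>With the preimages as columns of \<open>A\<close>, a dependence between them is
    a nonzero kernel vector of \<open>A\<close>, which is then also a kernel vector of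
    \<open>B = X * A\<close>.\<close>
  define A where "A = mat_of_cols m (map f us)"
  define B where "B = mat_of_cols n us"
  have A: "A \<in> carrier_mat m (length us)" and B: "B \<in> carrier_mat n (length us)"
    by (auto simp: A_def B_def)
  have fc: "f u \<in> carrier_vec m" if "u \<in> U" for u
    using f(1)[OF that] Y cols_dim by blast
  have uc: "u \<in> carrier_vec n" if "u \<in> U" for u
    using f(2)[OF that] fc[OF that] X by (metis mult_mat_vec_carrier)
  have cA: "cols A = map f us" and cB: "cols B = us"
    using fc uc us unfolding A_def B_def by (auto intro!: cols_mat_of_cols)
  have XA: "X * A = B"
  proof (rule eq_matI)
    fix i j assume ij: "i < dim_row B" "j < dim_col B"
    then have j: "us ! j \<in> U" using us B by auto
    have "col (X * A) j = X *\<^sub>v col A j" using X A B ij by (intro col_mult2[of _ _ m]) auto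
    also have "\<dots> = us ! j" using ij B f(2)[OF j] fc[OF j] by (auto simp: A_def)
    also have "\<dots> = col B j" using ij uc[OF j] B by (auto simp: B_def)
    finally have "col (X * A) j $ i = col B j $ i" by simp
    then show "(X * A) $$ (i, j) = B $$ (i, j)" using ij X A B by auto
  qed (use X A B in auto)
  have "W.lin_indpt (set (cols A))"
  proof
    assume "W.lin_dep (set (cols A))"
    moreover have "distinct (cols A)" using cA us inj by (simp add: distinct_map)
    ultimately obtain v where v: "v \<in> carrier_vec (length us)" "v \<noteq> 0\<^sub>v (length us)" "A *\<^sub>v v = 0\<^sub>v m"
      using W.lin_depE[OF A] by blast
    have "B *\<^sub>v v = 0\<^sub>v n"
      unfolding XA[symmetric] assoc_mult_mat_vec[OF X A v(1)] v(3)
      using X by (simp add: mult_mat_vec_def scalar_prod_def zero_vec_def)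
    then show False using lin_depI[OF B v(1,2)] cB us U(2) by auto
  qed
  moreover have "card (set (cols A)) = card U" using cA us inj by (simp add: card_image)
  moreover have "set (cols A) \<subseteq> set (cols Y)" using cA us f(1) by auto
  ultimately show ?thesis by blast
qed

lemma (in vec_space) obtain_max_indpt_cols:
  assumes "A \<in> carrier_mat n nc"
  obtains U where "U \<subseteq> set (cols A)" "lin_indpt U" "card U = rank A"
proof -
  have "lin_indpt {}" by (auto simp: lin_dep_def)
  then obtain U where "maximal U (\<lambda>T. T \<subseteq> set (cols A) \<and> lin_indpt T)"
    using maximal_exists_superset[of "set (cols A)" "\<lambda>T. T \<subseteq> set (cols A) \<and> lin_indpt T" "{}"]
    by auto
  then show thesis
    using that rank_card_indpt[OF assms] unfolding maximal_def by metis
qed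

text \<open>A maximal independent set of columns of the product lifts to an independent set of
  columns of \<open>Y\<close>.\<close>

lemma rank_mult_le_right:
  fixes X Y :: "'a :: field mat"
  assumes X: "X \<in> carrier_mat n m" and Y: "Y \<in> carrier_mat m nc"
  shows "vec_space.rank n (X * Y) \<le> vec_space.rank m Y"
proof -
  interpret V: vec_space "TYPE('a)" n .
  interpret W: vec_space "TYPE('a)" m .
  have XY: "X * Y \<in> carrier_mat n nc" using X Y by simp
  obtain U where U: "U \<subseteq> set (cols (X * Y))" "V.lin_indpt U" "card U = V.rank (X * Y)"
    using V.obtain_max_indpt_cols[OF XY] .
  then show ?thesis
    using V.lin_indpt_lift_cols[OF X Y U(1,2)] W.rank_ge_card_indpt[OF Y] by metis
qed

lemma (in vec_space) rank_eq_if_cols_in_span: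
  assumes A: "A \<in> carrier_mat n nc" and B: "B \<in> carrier_mat n nc'"
    and "set (cols A) \<subseteq> span (set (cols B))" "set (cols B) \<subseteq> span (set (cols A))"
  shows "rank A = rank B"
proof -
  have "set (cols A) \<subseteq> carrier_vec n" "set (cols B) \<subseteq> carrier_vec n" using A B cols_dim by blast+
  then have "span (set (cols A)) = span (set (cols B))"
    using assms(3,4) span_subsetI by (metis subset_antisym)
  then show ?thesis unfolding rank_def by simp
qed

text \<open>Appending to a symmetric matrix a border that repeats a combination of its rows and columns
  is a congruence and keeps the rank; conversely, if the rank stays, lifting a maximal independent
  set of columns shows that the new column lies in the span of the old ones.\<close>

lemma rank_border_iff:
  fixes A :: "'a :: field mat" and c :: 'a
  assumes A: "A \<in> carrier_mat n n" and sym: "transpose_mat A = A"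
    and b: "b \<in> carrier_vec n"
  defines "B \<equiv> four_block_mat A (transpose_mat (mat_of_row b)) (mat_of_row b) (mat 1 1 (\<lambda>_. c))"
  shows "vec_space.rank n A = vec_space.rank (n + 1) B \<longleftrightarrow>
    (\<exists>w \<in> carrier_vec n. A *\<^sub>v w = b \<and> scalar_prod b w = c)"
proof -
  interpret V: vec_space "TYPE('a)" n .
  interpret W: vec_space "TYPE('a)" "n + 1" .
  \<comment> \<open>\<open>C\<close> is \<open>B\<close> without its last column and
    \<open>E\<close> selects the first \<open>n\<close> coordinates, so that
    \<open>E * C = A\<close> and independent columns of \<open>A\<close> lift to columns of
    \<open>C\<close>.\<close>
  define C where "C = mat (n + 1) n (\<lambda>(i, j). B $$ (i, j))"
  define E where "E = mat n (n + 1) (\<lambda>(i, j). if i = j then 1 else (0 :: 'a))"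
  have Bc: "B \<in> carrier_mat (n + 1) (n + 1)" and C: "C \<in> carrier_mat (n + 1) n"
    and E: "E \<in> carrier_mat n (n + 1)"
    using A b by (auto simp: B_def C_def E_def mat_of_row_def)
  have Bidx: "B $$ (i, j) = (if i < n then if j < n then A $$ (i, j) else b $ i
      else if j < n then b $ j else c)" if "i < n + 1" "j < n + 1" for i j
    using that A b by (auto simp: B_def mat_of_row_def)
  have EC: "E * C = A"
  proof (rule eq_matI)
    fix i j assume ij: "i < dim_row A" "j < dim_col A"
    then have "(E * C) $$ (i, j) = (\<Sum>l = 0..<n + 1. (if i = l then 1 else 0) * B $$ (l, j))"
      using A E C by (auto simp: scalar_prod_def E_def C_def intro!: sum.cong)
    also have "\<dots> = (\<Sum>l = 0..<n + 1. if i = l then B $$ (l, j) else 0)"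
      by (intro sum.cong) auto
    also have "\<dots> = A $$ (i, j)" using ij A Bidx by (simp add: sum.delta)
    finally show "(E * C) $$ (i, j) = A $$ (i, j)" .
  qed (use A E C in auto)
  have cols_C: "set (cols C) \<subseteq> set (cols B)"
  proof
    fix v assume "v \<in> set (cols C)"
    then obtain j where j: "j < n" "v = col C j" using C by (auto simp: cols_def)
    then have "v = col B j" using Bc C by (intro eq_vecI) (auto simp: C_def)
    then show "v \<in> set (cols B)" using j Bc by (auto simp: cols_def)
  qed
  have BcolsC: "set (cols B) \<subseteq> carrier_vec (n + 1)" using cols_dim[of B] Bc by simp
  have CcolsC: "set (cols C) \<subseteq> carrier_vec (n + 1)" using cols_dim[of C] C by simp
  have lastB: "col B n \<in> set (cols B)" using Bc by (auto simp: cols_def)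
  have Cw: "C *\<^sub>v w = col B n \<longleftrightarrow> A *\<^sub>v w = b \<and> scalar_prod b w = c" if w: "w \<in> carrier_vec n" for w
  proof -
    have "(C *\<^sub>v w) $ i = (A *\<^sub>v w) $ i" if "i < n" for i
      using that w A C Bidx by (auto simp: C_def scalar_prod_def intro!: sum.cong)
    moreover have "(C *\<^sub>v w) $ n = scalar_prod b w"
      using w A C b Bidx by (auto simp: C_def scalar_prod_def intro!: sum.cong)
    ultimately show ?thesis
      using A b C Bc w Bidx by (auto simp: vec_eq_iff less_Suc_eq)
  qed
  have rank_A_le: "\<exists>U \<subseteq> set (cols C). card U = V.rank A \<and> W.lin_indpt U"
  proof -
    obtain U where U: "U \<subseteq> set (cols A)" "V.lin_indpt U" "card U = V.rank A"
      using V.obtain_max_indpt_cols[OF A] .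
    show ?thesis using V.lin_indpt_lift_cols[OF E C, unfolded EC, OF U(1,2)] U(3) by metis
  qed
  show ?thesis
  proof
    assume eq: "V.rank A = W.rank B"
    obtain U where U: "U \<subseteq> set (cols C)" "card U = W.rank B" "W.lin_indpt U"
      using rank_A_le eq by auto
    have finU: "finite U" using U(1) finite_subset by blast
    \<comment> \<open>\<open>U\<close> has as many elements as the rank of \<open>B\<close>, so
      adjoining a vector outside its span would give too many independent columns.\<close>
    have "col B n \<in> W.span U"
    proof (rule ccontr)
      assume no: "col B n \<notin> W.span U"
      have Uc: "U \<subseteq> carrier_vec (n + 1)" using U(1) CcolsC by blast
      have notin: "col B n \<notin> U" using no W.in_own_span[of U] Uc by auto
      have "W.lin_indpt (U \<union> {col B n})"
        using no W.lindep_span W.lin_dep_iff_in_span[of U "col B n"] Uc U(3) notin BcolsC lastB by auto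
      then have "card (U \<union> {col B n}) \<le> W.rank B"
        using U(1) cols_C lastB by (intro W.rank_ge_card_indpt[OF Bc]) auto
      then show False using notin finU U(2) by simp
    qed
    then have "col B n \<in> W.col_space C"
      using U(1) W.span_is_monotone unfolding W.col_space_def by blast
    then obtain w where "w \<in> carrier_vec n" "C *\<^sub>v w = col B n"
      using W.col_space_eq[OF C] C by auto
    then show "\<exists>w \<in> carrier_vec n. A *\<^sub>v w = b \<and> scalar_prod b w = c" using Cw by blast
  next
    assume "\<exists>w \<in> carrier_vec n. A *\<^sub>v w = b \<and> scalar_prod b w = c"
    then obtain w where w: "w \<in> carrier_vec n" "A *\<^sub>v w = b" "scalar_prod b w = c" by blast
    have bw: "b $ i = scalar_prod (row A i) w" if "i < n" for i using w(2) that A by auto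
    have "col B n \<in> W.span (set (cols C))"
      using W.col_space_eq[OF C] Cw[OF w(1)] w C Bc col_carrier_vec[OF _ Bc, of n]
      unfolding W.col_space_def by auto
    moreover have "col B j \<in> W.span (set (cols C))" if "j < n" for j
    proof -
      have "col B j = col C j" using that Bc C by (intro eq_vecI) (auto simp: C_def)
      then show ?thesis using that C W.in_own_span[OF CcolsC[folded module_vec_simps]]
        by (auto simp: cols_def)
    qed
    ultimately have "set (cols B) \<subseteq> W.span (set (cols C))"
      using Bc by (auto simp: cols_def less_Suc_eq)
    moreover have "set (cols C) \<subseteq> W.span (set (cols B))"
      using cols_C W.in_own_span[of "set (cols B)"] BcolsC by auto
    ultimately have BC: "W.rank B = W.rank C"
      using W.rank_eq_if_cols_in_span[OF Bc C] by blast
    \<comment> \<open>\<open>P\<close> is the identity with the row \<open>w\<close> below it. By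
      symmetry of \<open>A\<close> the last row of \<open>P * A\<close> is the border
      \<open>b\<close>.\<close>
    define P where "P = mat (n + 1) n (\<lambda>(i, j). if i < n then if i = j then 1 else 0 else w $ j)"
    have P: "P \<in> carrier_mat (n + 1) n" by (simp add: P_def)
    have PA: "P * A = C"
    proof (rule eq_matI)
      fix i j assume ij: "i < dim_row C" "j < dim_col C"
      then have i: "i < n + 1" and j: "j < n" using C by auto
      have "(P * A) $$ (i, j) = (\<Sum>l = 0..<n. P $$ (i, l) * A $$ (l, j))"
        using i j P A by (auto simp: scalar_prod_def)
      also have "\<dots> = C $$ (i, j)"
      proof (cases "i < n")
        case True
        have "(\<Sum>l = 0..<n. P $$ (i, l) * A $$ (l, j)) = (\<Sum>l = 0..<n. if i = l then A $$ (l, j) else 0)"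
          using True by (intro sum.cong) (auto simp: P_def)
        then show ?thesis using True j Bidx by (simp add: C_def)
      next
        case False
        have Aji: "A $$ (l, j) = A $$ (j, l)" if "l < n" for l
          using arg_cong[OF sym, of "\<lambda>M. M $$ (l, j)"] that j A by auto
        have "(\<Sum>l = 0..<n. P $$ (i, l) * A $$ (l, j)) = (\<Sum>l = 0..<n. w $ l * A $$ (j, l))"
          using False i Aji by (intro sum.cong) (auto simp: P_def)
        also have "\<dots> = scalar_prod (row A j) w" using w(1) j A
          by (auto simp: scalar_prod_def mult.commute intro!: sum.cong)
        finally show ?thesis using False i j Bidx bw by (simp add: C_def)
      qed
      finally show "(P * A) $$ (i, j) = C $$ (i, j)" .
    qed (use P A C in auto)
    have "W.rank B \<le> V.rank A" unfolding BC PA[symmetric] by (rule rank_mult_le_right[OF P A])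
    moreover have "V.rank A \<le> W.rank B"
      using rank_A_le W.rank_ge_card_indpt[OF Bc] cols_C by (metis subset_trans)
    ultimately show "V.rank A = W.rank B" by simp
  qed
qed

text \<open>The combinations of the first \<open>i\<close> columns form the column space of the
  matrix \<open>M\<close> cut off after them. For \<open>i = 0\<close> the sum is empty and the
  criterion says that \<open>v\<close> is zero.\<close>

lemma col_in_vspan_iff:
  assumes A: "A \<in> carrier_mat n nc" and i: "i \<le> nc" and v: "v \<in> carrier_vec n"
  shows "v \<in> vspan n (col A ` {..<i}) \<longleftrightarrow>
    (\<exists>c. \<forall>j<n. v $ j = (\<Sum>l<i. A $$ (j, l) * c l))"
proof -
  interpret W: vec_space "TYPE(real)" n .
  define M where "M = mat n i (\<lambda>(r, s). A $$ (r, s))"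
  have M: "M \<in> carrier_mat n i" by (simp add: M_def)
  have "col M s = col A s" if "s < i" for s
    using that A i M by (intro eq_vecI) (auto simp: M_def)
  then have "set (cols M) = col A ` {..<i}" using M by (auto simp: cols_def)
  then have *: "v \<in> vspan n (col A ` {..<i}) \<longleftrightarrow> (\<exists>x \<in> carrier_vec i. M *\<^sub>v x = v)"
    using W.col_space_eq[OF M] M v unfolding W.col_space_def by auto
  have idx: "(M *\<^sub>v x) $ j = (\<Sum>l<i. A $$ (j, l) * x $ l)" if "x \<in> carrier_vec i" "j < n" for x j
    using that M by (auto simp: scalar_prod_def M_def lessThan_atLeast0 intro!: sum.cong)
  show ?thesis unfolding *
  proof
    assume "\<exists>x \<in> carrier_vec i. M *\<^sub>v x = v"
    then show "\<exists>c. \<forall>j<n. v $ j = (\<Sum>l<i. A $$ (j, l) * c l)" using idx by metis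
  next
    assume "\<exists>c. \<forall>j<n. v $ j = (\<Sum>l<i. A $$ (j, l) * c l)"
    then obtain c where c: "\<forall>j<n. v $ j = (\<Sum>l<i. A $$ (j, l) * c l)" by blast
    have "M *\<^sub>v vec i c = v"
      using c v M idx[of "vec i c"] by (intro eq_vecI) auto
    then show "\<exists>x \<in> carrier_vec i. M *\<^sub>v x = v" by (intro bexI[of _ "vec i c"]) auto
  qed
qed

section \<open>Real-rooted polynomials and Gaussian quadrature\<close>

lemma map_poly_of_real_add:
  "map_poly of_real (p + q) = map_poly of_real p + (map_poly of_real q :: complex poly)"
  by (intro poly_eqI) (simp add: coeff_map_poly)

lemma map_poly_of_real_mult:
  "map_poly of_real (p * q) = map_poly of_real p * (map_poly of_real q :: complex poly)"
  by (intro poly_eqI) (simp add: coeff_map_poly coeff_mult)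

lemma poly_map_poly_of_real:
  "poly (map_poly of_real p) (of_real x :: complex) = of_real (poly p x)"
  by (induction p) (simp_all add: map_poly_pCons)

text \<open>The quadratic is the minimal real polynomial of \<open>z\<close>. The remainder of
  \<open>p\<close> modulo it has degree at most 1 and vanishes at \<open>z\<close>; comparing
  imaginary and real parts shows that it is zero.\<close>

lemma nonreal_root_imp_quadratic_dvd:
  fixes p :: "real poly"
  assumes z: "poly (map_poly complex_of_real p) z = 0" and im: "Im z \<noteq> 0"
  shows "[:- Re z, 1:]\<^sup>2 + [:(Im z)\<^sup>2:] dvd p"
proof -
  define Q where "Q = [:- Re z, 1:]\<^sup>2 + [:(Im z)\<^sup>2:]"
  have Qeq: "Q = [:(Re z)\<^sup>2 + (Im z)\<^sup>2, - 2 * Re z, 1:]"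
    by (simp add: Q_def power2_eq_square)
  have degQ: "degree Q = 2" and Q0: "Q \<noteq> 0" by (simp_all add: Qeq)
  define r where "r = p mod Q"
  have degr: "degree r \<le> 1"
    using degree_mod_less[OF Q0, of p] degQ unfolding r_def by auto
  have r: "r = [:c, d:]" if "c = coeff r 0" "d = coeff r 1" for c d
    using degr that by (intro poly_eqI) (auto simp: coeff_pCons coeff_eq_0 split: nat.split)
  then obtain c d where r: "r = [:c, d:]" by blast
  have Qz: "poly (map_poly complex_of_real Q) z = 0"
    by (simp add: Qeq map_poly_pCons complex_eq_iff power2_eq_square algebra_simps)
  have "p = Q * (p div Q) + r" by (simp add: r_def)
  then have "map_poly complex_of_real p =
      map_poly complex_of_real Q * map_poly complex_of_real (p div Q) + map_poly complex_of_real r"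
    by (metis map_poly_of_real_add map_poly_of_real_mult)
  then have "poly (map_poly complex_of_real r) z = 0"
    using z Qz by simp
  then have "complex_of_real c + z * complex_of_real d = 0"
    by (simp add: r map_poly_pCons)
  then have "Im z * d = 0" "c + Re z * d = 0" by (simp_all add: complex_eq_iff)
  then have "r = 0" using im r by simp
  then show ?thesis unfolding Q_def[symmetric] r_def by (simp add: mod_eq_0_iff_dvd)
qed

text \<open>The case \<open>b = 0\<close> of the second hypothesis excludes multiple roots.\<close>

lemma card_roots_eq_degree:
  fixes p :: "real poly"
  assumes "p \<noteq> 0" and "\<And>a b. \<not> [:- a, 1:]\<^sup>2 + [:b\<^sup>2:] dvd p"
  shows "card {x. poly p x = 0} = degree p"
  using assms
proof (induction "degree p" arbitrary: p)
  case 0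
  then obtain c where "p = [:c:]" by (metis degree_eq_zeroE)
  then have "{x. poly p x = 0} = {}" using 0 by auto
  then show ?case using 0 by simp
next
  case (Suc n)
  have "degree (map_poly complex_of_real p) = degree p" by (intro degree_map_poly) simp
  then have "\<not> constant (poly (map_poly complex_of_real p))"
    using Suc.hyps(2) by (simp add: constant_degree)
  then obtain z where z: "poly (map_poly complex_of_real p) z = 0"
    using fundamental_theorem_of_algebra by blast
  \<comment> \<open>A nonreal root would supply an excluded quadratic factor with
    \<open>b = Im z\<close>.\<close>
  have "Im z = 0" using nonreal_root_imp_quadratic_dvd[OF z] Suc.prems(2) by blast
  then have "z = complex_of_real (Re z)" by (simp add: complex_eq_iff)
  define a where "a = Re z"
  have "poly p a = 0"
    using z \<open>z = _\<close> unfolding a_def by (metis of_real_eq_0_iff poly_map_poly_of_real)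
  then obtain r where r: "p = [:- a, 1:] * r" by (auto simp: poly_eq_0_iff_dvd elim: dvdE)
  have r0: "r \<noteq> 0" using r Suc.prems(1) by auto
  have degp: "degree p = Suc (degree r)"
    unfolding r using r0 by (simp add: degree_mult_eq del: mult_pCons_left)
  have "\<not> [:- b, 1:]\<^sup>2 + [:c\<^sup>2:] dvd r" for b c
    using Suc.prems(2)[of b c] r dvd_mult by blast
  then have IH: "card {x. poly r x = 0} = degree r"
    using Suc.hyps degp r0 by auto
  have "poly r a \<noteq> 0"
  proof
    assume "poly r a = 0"
    then obtain s where "r = [:- a, 1:] * s" by (auto simp: poly_eq_0_iff_dvd elim: dvdE)
    then have "p = [:- a, 1:]\<^sup>2 * s" unfolding r by (simp only: power2_eq_square mult.assoc)
    then have "[:- a, 1:]\<^sup>2 + [:0\<^sup>2:] dvd p" by (simp only: power_zero_numeral pCons_0_0 add_0_right dvd_triv_left)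
    then show False using Suc.prems(2) by blast
  qed
  moreover have "{x. poly p x = 0} = insert a {x. poly r x = 0}" using r by auto
  ultimately show ?case using IH degp poly_roots_finite[OF r0] by simp
qed

section \<open>The Riesz functional of a sequence\<close>

definition riesz :: "(nat \<Rightarrow> real) \<Rightarrow> real poly \<Rightarrow> real" where
  "riesz \<beta> p = (\<Sum>i\<le>degree p. coeff p i * \<beta> i)"

text \<open>Coefficients above the degree are zero, so one bound \<open>n\<close> can serve several
  polynomials at once.\<close>

lemma riesz_altdef:
  assumes "degree p \<le> n"
  shows "riesz \<beta> p = (\<Sum>i\<le>n. coeff p i * \<beta> i)"
  unfolding riesz_def using assms
  by (intro sum.mono_neutral_left) (auto simp: coeff_eq_0)

lemma riesz_add [simp]: "riesz \<beta> (p + q) = riesz \<beta> p + riesz \<beta> q"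
proof -
  define n where "n = max (degree p) (degree q)"
  have "degree p \<le> n" "degree q \<le> n" "degree (p + q) \<le> n"
    by (auto simp: n_def degree_add_le_max)
  then show ?thesis by (simp add: riesz_altdef[of _ n] sum.distrib algebra_simps)
qed

lemma riesz_smult [simp]: "riesz \<beta> (Polynomial.smult c p) = c * riesz \<beta> p"
  by (simp add: riesz_altdef[of _ "degree p"] sum_distrib_left mult.assoc)

lemma riesz_0 [simp]: "riesz \<beta> 0 = 0"
  by (simp add: riesz_def)

lemma riesz_uminus [simp]: "riesz \<beta> (- p) = - riesz \<beta> p"
  using riesz_smult[of \<beta> "-1" p] by simp

lemma riesz_diff [simp]: "riesz \<beta> (p - q) = riesz \<beta> p - riesz \<beta> q"
  using riesz_add[of \<beta> p "- q"] by simp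

lemma riesz_sum: "riesz \<beta> (\<Sum>i\<in>I. f i) = (\<Sum>i\<in>I. riesz \<beta> (f i))"
  by (induction I rule: infinite_finite_induct) auto

lemma riesz_monom [simp]: "riesz \<beta> (monom 1 n) = \<beta> n"
proof -
  have "riesz \<beta> (monom 1 n) = (\<Sum>i\<le>n. if n = i then \<beta> i else 0)"
    unfolding riesz_altdef[OF degree_monom_le] by (intro sum.cong) auto
  then show ?thesis by simp
qed

lemma riesz_monom': "riesz \<beta> (monom c n) = c * \<beta> n"
  using riesz_smult[of \<beta> c "monom 1 n"] by (simp add: smult_monom del: riesz_smult)

lemma riesz_cong:
  assumes "degree p \<le> n" "\<And>i. i \<le> n \<Longrightarrow> coeff p i \<noteq> 0 \<Longrightarrow> \<beta> i = \<gamma> i"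
  shows "riesz \<beta> p = riesz \<gamma> p"
  unfolding riesz_altdef[OF assms(1)] using assms(2) by (intro sum.cong) auto

lemma riesz_mult_monom:
  assumes "degree p \<le> n"
  shows "riesz \<beta> (p * monom 1 j) = (\<Sum>i\<le>n. coeff p i * \<beta> (i + j))"
proof -
  have "p * monom 1 j = (\<Sum>i\<le>n. Polynomial.smult (coeff p i) (monom 1 (i + j)))"
    by (subst poly_as_sum_of_monoms'[OF assms, symmetric])
      (simp add: sum_distrib_right mult_monom smult_monom)
  then show ?thesis by (simp add: riesz_sum)
qed

lemma riesz_mult:
  assumes "degree q \<le> n"
  shows "riesz \<beta> (p * q) = (\<Sum>j\<le>n. coeff q j * riesz \<beta> (p * monom 1 j))"
proof -
  have "p * q = (\<Sum>j\<le>n. Polynomial.smult (coeff q j) (p * monom 1 j))"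
    by (subst poly_as_sum_of_monoms'[OF assms, symmetric])
      (simp add: sum_distrib_left smult_monom flip: mult_smult_right)
  then show ?thesis by (simp add: riesz_sum)
qed

lemma riesz_mult_eq_0:
  assumes "\<And>j. j \<le> n \<Longrightarrow> riesz \<beta> (p * monom 1 j) = 0" and "degree q \<le> n"
  shows "riesz \<beta> (p * q) = 0"
  unfolding riesz_mult[OF assms(2)] using assms(1) by simp

lemma riesz_mult_double_sum:
  assumes "degree p \<le> n" "degree q \<le> n"
  shows "riesz \<beta> (p * q) = (\<Sum>i\<le>n. \<Sum>j\<le>n. coeff p i * coeff q j * \<beta> (i + j))"
  unfolding riesz_mult[OF assms(2)] riesz_mult_monom[OF assms(1)] sum_distrib_left
  by (subst sum.swap) (simp add: mult_ac)

section \<open>Lagrange interpolation and Gaussian quadrature\<close>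

definition lagrange_poly :: "real set \<Rightarrow> real \<Rightarrow> real poly" where
  "lagrange_poly S a = (\<Prod>b\<in>S - {a}. Polynomial.smult (1 / (a - b)) [:- b, 1:])"

lemma poly_lagrange_poly:
  assumes "finite S" "a \<in> S" "b \<in> S"
  shows "poly (lagrange_poly S a) b = (if a = b then 1 else 0)"
proof (cases "a = b")
  case True
  have "poly (lagrange_poly S a) a = (\<Prod>x\<in>S - {a}. 1)"
    unfolding lagrange_poly_def poly_prod by (intro prod.cong) (auto simp: diff_divide_distrib[symmetric])
  then show ?thesis using True by simp
next
  case False
  then show ?thesis using assms by (auto simp: lagrange_poly_def poly_prod intro!: prod_zero bexI[of _ b])
qed

lemma degree_lagrange_poly:
  assumes "finite S" "a \<in> S"
  shows "degree (lagrange_poly S a) < card S"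
proof -
  have "degree (lagrange_poly S a) \<le> (\<Sum>b\<in>S - {a}. degree (Polynomial.smult (1 / (a - b)) [:- b, 1:]))"
    unfolding lagrange_poly_def using assms by (intro degree_prod_sum_le[THEN order_trans]) (auto simp: o_def)
  also have "\<dots> = card (S - {a})" by simp
  also have "\<dots> < card S" using assms by (rule card_Diff1_less)
  finally show ?thesis .
qed

text \<open>A nonzero remainder of \<open>f\<close> modulo \<open>p\<close> would have
  \<open>degree p\<close> roots although its degree is smaller.\<close>

lemma poly_dvd_if_vanishes_on_roots:
  fixes p f :: "real poly"
  assumes "p \<noteq> 0" "card {x. poly p x = 0} = degree p" and "\<And>x. poly p x = 0 \<Longrightarrow> poly f x = 0"
  shows "p dvd f"
proof -
  have "f mod p = 0"
  proof (rule ccontr)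
    assume r: "f mod p \<noteq> 0"
    have "poly (f mod p) x = 0" if "poly p x = 0" for x
      using assms(3)[OF that] that arg_cong[OF div_mult_mod_eq[of f p], of "\<lambda>g. poly g x"]
      unfolding poly_add poly_mult by simp
    then have "card {x. poly p x = 0} \<le> card {x. poly (f mod p) x = 0}"
      using poly_roots_finite[OF r] by (intro card_mono) auto
    also have "\<dots> \<le> degree (f mod p)" by (rule card_poly_roots_bound[OF r])
    finally show False using assms degree_mod_less[OF assms(1), of f] r by auto
  qed
  then show ?thesis by (simp add: mod_eq_0_iff_dvd)
qed

text \<open>Gaussian quadrature: \<open>p\<close> has only simple real roots because it is orthogonal to its
  cofactor \<open>r\<close> for every factor \<open>(t - a)\<^sup>2 + b\<^sup>2\<close>, whereas \<open>((t - a)\<^sup>2 + b\<^sup>2) r\<^sup>2\<close> is a sum of squares.\<close>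

lemma gauss_quadrature:
  fixes p :: "real poly"
  assumes pos: "\<And>q. q \<noteq> 0 \<Longrightarrow> degree q < degree p \<Longrightarrow> riesz \<beta> (q * q) > 0"
    and p0: "p \<noteq> 0"
    and orth: "\<And>j. j \<le> N \<Longrightarrow> riesz \<beta> (p * monom 1 j) = 0"
    and N: "degree p \<le> N + 1"
  obtains S w where "finite S" "card S = degree p" "\<And>a. a \<in> S \<Longrightarrow> 0 < w a"
    "\<And>f. degree f \<le> degree p + N \<Longrightarrow> riesz \<beta> f = (\<Sum>a\<in>S. w a * poly f a)"
proof -
  have orth': "riesz \<beta> (p * q) = 0" if "degree q \<le> N" for q
    using riesz_mult_eq_0[OF orth that] .
  have nodvd: "\<not> [:- a, 1:]\<^sup>2 + [:b\<^sup>2:] dvd p" for a b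
  proof
    assume "[:- a, 1:]\<^sup>2 + [:b\<^sup>2:] dvd p"
    then obtain r where r: "p = ([:- a, 1:]\<^sup>2 + [:b\<^sup>2:]) * r" by (elim dvdE)
    have Qeq: "[:- a, 1:]\<^sup>2 + [:b\<^sup>2:] = [:a\<^sup>2 + b\<^sup>2, - 2 * a, 1:]" by (simp add: power2_eq_square)
    have r0: "r \<noteq> 0" using r p0 by auto
    have deg: "degree p = degree r + 2" unfolding r Qeq
      by (subst degree_mult_eq) (auto simp: r0)
    define s where "s = [:- a, 1:] * r"
    have s0: "s \<noteq> 0" and degs: "degree s = degree r + 1"
      using r0 by (auto simp: s_def degree_mult_eq simp del: mult_pCons_left)
    have "(X\<^sup>2 + B) * r * r = (X * r) * (X * r) + B * (r * r)" for X B :: "real poly"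
      by (simp add: power2_eq_square algebra_simps)
    then have "p * r = s * s + Polynomial.smult (b\<^sup>2) (r * r)"
      unfolding r s_def by simp
    then have "riesz \<beta> (p * r) = riesz \<beta> (s * s) + b\<^sup>2 * riesz \<beta> (r * r)" by simp
    moreover have "riesz \<beta> (s * s) > 0" "riesz \<beta> (r * r) > 0" using pos s0 r0 degs deg by auto
    moreover have "riesz \<beta> (p * r) = 0" using orth' deg N by auto
    ultimately have "0 < riesz \<beta> (s * s)" "0 \<le> b\<^sup>2 * riesz \<beta> (r * r)"
      "riesz \<beta> (s * s) + b\<^sup>2 * riesz \<beta> (r * r) = 0" by simp_all
    then show False by linarith
  qed
  define S where "S = {x. poly p x = 0}"
  have cardS: "card S = degree p" unfolding S_def by (rule card_roots_eq_degree[OF p0 nodvd])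
  have finS: "finite S" unfolding S_def by (rule poly_roots_finite[OF p0])
  \<comment> \<open>Exactness for the Lagrange polynomials, each of which is 1 at its own node and 0
    at the others, forces these weights.\<close>
  define w where "w a = riesz \<beta> (lagrange_poly S a)" for a
  \<comment> \<open>Such an \<open>f\<close> is \<open>p\<close> times a polynomial of degree at
    most \<open>N\<close>, to which \<open>p\<close> is orthogonal.\<close>
  have vanish: "riesz \<beta> f = 0" if "degree f \<le> degree p + N" "\<And>x. x \<in> S \<Longrightarrow> poly f x = 0" for f
  proof -
    have "p dvd f"
      using poly_dvd_if_vanishes_on_roots[OF p0] cardS that(2) unfolding S_def by auto
    then obtain q where q: "f = p * q" by (elim dvdE)
    have "q = 0 \<or> degree q \<le> N" using that(1) p0 unfolding q by (cases "q = 0") (auto simp: degree_mult_eq)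
    then show ?thesis using orth' q by auto
  qed
  have formula: "riesz \<beta> f = (\<Sum>a\<in>S. w a * poly f a)" if f: "degree f \<le> degree p + N" for f
  proof -
    \<comment> \<open>This is the interpolant of \<open>f\<close> at the nodes, so
      \<open>f - g\<close> vanishes there and has value 0.\<close>
    define g where "g = (\<Sum>a\<in>S. Polynomial.smult (poly f a) (lagrange_poly S a))"
    have "degree g \<le> degree p + N" unfolding g_def
    proof (intro degree_sum_le[OF finS])
      fix a assume "a \<in> S"
      then show "degree (Polynomial.smult (poly f a) (lagrange_poly S a)) \<le> degree p + N"
        using degree_lagrange_poly[OF finS, of a] degree_smult_le[of "poly f a" "lagrange_poly S a"]
          cardS by linarith
    qed
    then have "degree (f - g) \<le> degree p + N" using f degree_diff_le by blast
    moreover have "poly (f - g) x = 0" if "x \<in> S" for x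
      using that finS by (simp add: g_def poly_sum poly_lagrange_poly if_distrib cong: if_cong)
    ultimately have "riesz \<beta> (f - g) = 0" using vanish by blast
    then show ?thesis by (simp add: g_def riesz_sum w_def mult.commute)
  qed
  have wpos: "w a > 0" if a: "a \<in> S" for a
  proof -
    let ?l = "lagrange_poly S a"
    have l0: "?l \<noteq> 0" using poly_lagrange_poly[OF finS a a] by auto
    have dl: "degree ?l < degree p" using degree_lagrange_poly[OF finS a] cardS by simp
    \<comment> \<open>The values 0 and 1 at the nodes are idempotent, so the Lagrange polynomial has
      the same functional value as its square, which is positive.\<close>
    have "degree (?l * ?l - ?l) \<le> degree p + N"
      using dl N degree_mult_le[of ?l ?l] by (intro degree_diff_le) auto
    then have "riesz \<beta> (?l * ?l - ?l) = 0"
      using a finS by (intro vanish) (auto simp: poly_lagrange_poly)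
    then show ?thesis using pos[OF l0 dl] by (simp add: w_def)
  qed
  show thesis using that[OF finS cardS wpos formula] .
qed

section \<open>Hankel matrices\<close>

lemma hankel_carrier [simp]: "hankel m \<gamma> \<in> carrier_mat (m + 1) (m + 1)"
  by (simp add: hankel_def)

lemma dim_hankel [simp]: "dim_row (hankel m \<gamma>) = m + 1" "dim_col (hankel m \<gamma>) = m + 1"
  by (simp_all add: hankel_def)

lemma hankel_index [simp]: "i \<le> m \<Longrightarrow> j \<le> m \<Longrightarrow> hankel m \<gamma> $$ (i, j) = \<gamma> (i + j)"
  by (simp add: hankel_def)

lemma transpose_hankel [simp]: "transpose_mat (hankel m \<gamma>) = hankel m \<gamma>"
  by (intro eq_matI) (auto simp: hankel_def add.commute)

text \<open>Identifies the kernel of the Hankel matrix with the polynomials of degree at most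
  \<open>m\<close> that are orthogonal to all powers up to \<open>m\<close>.\<close>

lemma hankel_mult_coeffs:
  assumes "degree p \<le> m" "j \<le> m"
  shows "(hankel m \<gamma> *\<^sub>v vec (m + 1) (coeff p)) $ j = riesz \<gamma> (p * monom 1 j)"
  unfolding riesz_mult_monom[OF assms(1)] using assms(2)
  by (auto simp: scalar_prod_def atLeast0LessThan lessThan_Suc_atMost mult.commute add.commute
      intro!: sum.cong simp del: sum.lessThan_Suc sum.atMost_Suc)

lemma hankel_quadratic_form:
  assumes "degree p \<le> m"
  shows "scalar_prod (vec (m + 1) (coeff p)) (hankel m \<gamma> *\<^sub>v vec (m + 1) (coeff p)) = riesz \<gamma> (p * p)"
proof -
  have "scalar_prod (vec (m + 1) (coeff p)) (hankel m \<gamma> *\<^sub>v vec (m + 1) (coeff p)) =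
      (\<Sum>j = 0..<m + 1. coeff p j * (hankel m \<gamma> *\<^sub>v vec (m + 1) (coeff p)) $ j)"
    by (auto simp: scalar_prod_def intro!: sum.cong)
  also have "\<dots> = (\<Sum>j = 0..<m + 1. coeff p j * riesz \<gamma> (p * monom 1 j))"
    using hankel_mult_coeffs[OF assms] by (intro sum.cong) auto
  also have "\<dots> = riesz \<gamma> (p * p)"
    unfolding riesz_mult[OF assms] by (simp add: atLeast0LessThan lessThan_Suc_atMost del: sum.lessThan_Suc)
  finally show ?thesis .
qed

lemma obtain_coeffs:
  fixes u :: "real vec"
  assumes "u \<in> carrier_vec (m + 1)"
  obtains p where "degree p \<le> m" "u = vec (m + 1) (coeff p)"
proof -
  define p where "p = (\<Sum>i\<le>m. monom (u $ i) i)"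
  have "degree p \<le> m" unfolding p_def
    by (intro degree_sum_le) (auto intro: degree_monom_le[THEN order_trans])
  moreover have "coeff p j = (if j \<le> m then u $ j else 0)" for j
    by (simp add: p_def coeff_sum)
  then have "u = vec (m + 1) (coeff p)" using assms by (intro eq_vecI) auto
  ultimately show thesis using that by blast
qed

lemma vec_coeff_eq_0_iff:
  assumes "degree p \<le> m"
  shows "vec (m + 1) (coeff p) = 0\<^sub>v (m + 1) \<longleftrightarrow> p = (0 :: real poly)"
proof
  assume *: "vec (m + 1) (coeff p) = 0\<^sub>v (m + 1)"
  show "p = 0"
  proof (intro poly_eqI)
    fix i
    show "coeff p i = coeff 0 i"
      using arg_cong[OF *, of "\<lambda>v. v $ i"] assms by (cases "i \<le> m") (auto simp: coeff_eq_0)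
  qed
qed auto

lemma psd_hankel_iff:
  "psd (hankel m \<gamma>) \<longleftrightarrow> (\<forall>p. degree p \<le> m \<longrightarrow> 0 \<le> riesz \<gamma> (p * p))"
proof -
  have "psd (hankel m \<gamma>) \<longleftrightarrow>
      (\<forall>u \<in> carrier_vec (m + 1). 0 \<le> scalar_prod u (hankel m \<gamma> *\<^sub>v u))"
    by (simp add: psd_def)
  also have "\<dots> \<longleftrightarrow> (\<forall>p. degree p \<le> m \<longrightarrow> 0 \<le> riesz \<gamma> (p * p))"
    using hankel_quadratic_form obtain_coeffs by (metis vec_carrier)
  finally show ?thesis .
qed

lemma pd_hankel_iff:
  "pd (hankel m \<gamma>) \<longleftrightarrow> (\<forall>p. p \<noteq> 0 \<longrightarrow> degree p \<le> m \<longrightarrow> 0 < riesz \<gamma> (p * p))"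
proof -
  have "pd (hankel m \<gamma>) \<longleftrightarrow>
      (\<forall>u \<in> carrier_vec (m + 1). u \<noteq> 0\<^sub>v (m + 1) \<longrightarrow> 0 < scalar_prod u (hankel m \<gamma> *\<^sub>v u))"
    by (simp add: pd_def)
  also have "\<dots> \<longleftrightarrow> (\<forall>p. p \<noteq> 0 \<longrightarrow> degree p \<le> m \<longrightarrow> 0 < riesz \<gamma> (p * p))"
    using hankel_quadratic_form obtain_coeffs vec_coeff_eq_0_iff by (metis vec_carrier)
  finally show ?thesis .
qed

text \<open>Since the square of \<open>p\<close> has value 0, the value of
  \<open>(q + t p)^2\<close> is affine in \<open>t\<close>, with twice the value of
  \<open>p * q\<close> as slope. It stays nonnegative only if the slope is zero.\<close>

lemma psd_hankel_kernel:
  assumes psd: "psd (hankel m \<gamma>)" and p: "degree p \<le> m" "riesz \<gamma> (p * p) = 0" and q: "degree q \<le> m"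
  shows "riesz \<gamma> (p * q) = 0"
proof (rule ccontr)
  assume nz: "riesz \<gamma> (p * q) \<noteq> 0"
  \<comment> \<open>At this \<open>t\<close> the affine expression takes the value -1.\<close>
  define t where "t = - (riesz \<gamma> (q * q) + 1) / (2 * riesz \<gamma> (p * q))"
  let ?f = "q + Polynomial.smult t p"
  have "degree ?f \<le> m" using p(1) q degree_smult_le[of t p] by (intro degree_add_le) auto
  then have "0 \<le> riesz \<gamma> (?f * ?f)" using psd psd_hankel_iff by blast
  also have "riesz \<gamma> (?f * ?f) = riesz \<gamma> (q * q) + 2 * t * riesz \<gamma> (p * q)"
    using p(2) by (simp add: distrib_left distrib_right mult.commute[of q p])
  also have "\<dots> = - 1" using nz by (simp add: t_def field_simps)
  finally show False by simp
qed

lemma pd_hankel_det: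
  assumes "pd (hankel m \<gamma>)"
  shows "det (hankel m \<gamma>) \<noteq> 0"
proof
  assume "det (hankel m \<gamma>) = 0"
  then obtain v where v: "v \<in> carrier_vec (m + 1)" "v \<noteq> 0\<^sub>v (m + 1)" "hankel m \<gamma> *\<^sub>v v = 0\<^sub>v (m + 1)"
    using det_0_iff_vec_prod_zero[OF hankel_carrier] by blast
  then show False using assms unfolding pd_def by fastforce
qed

lemma det_nonzero_imp_invertible_mat:
  fixes A :: "'a :: field mat"
  assumes A: "A \<in> carrier_mat n n" and "det A \<noteq> 0"
  shows "\<exists>B \<in> carrier_mat n n. A * B = 1\<^sub>m n \<and> B * A = 1\<^sub>m n"
  using det_non_zero_imp_unit[OF assms, of "()"] unfolding Units_def ring_mat_def by auto

text \<open>The Hankel matrix is invertible, and the solution of the linear system gives the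
  coefficients of \<open>f\<close>. The degree bound is put in terms of coefficients so that
  \<open>n = 0\<close> means \<open>f = 0\<close>.\<close>

lemma pd_riesz_solve:
  assumes pos: "\<And>q. q \<noteq> 0 \<Longrightarrow> degree q < n \<Longrightarrow> 0 < riesz \<gamma> (q * q)"
  obtains f where "\<And>i. i \<ge> n \<Longrightarrow> coeff f i = 0" "\<And>j. j < n \<Longrightarrow> riesz \<gamma> (f * monom 1 j) = c j"
proof (cases n)
  case 0
  then show thesis using that[of 0] by simp
next
  case (Suc m)
  have "pd (hankel m \<gamma>)" using pos Suc by (simp add: pd_hankel_iff)
  then obtain B where B: "B \<in> carrier_mat (m + 1) (m + 1)" "hankel m \<gamma> * B = 1\<^sub>m (m + 1)"
    using det_nonzero_imp_invertible_mat[OF hankel_carrier pd_hankel_det] by blast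
  define u where "u = B *\<^sub>v vec (m + 1) c"
  have u: "u \<in> carrier_vec (m + 1)" using B by (simp add: u_def)
  have Hu: "hankel m \<gamma> *\<^sub>v u = vec (m + 1) c"
    unfolding u_def assoc_mult_mat_vec[OF hankel_carrier B(1) vec_carrier, symmetric] B(2) by simp
  obtain f where f: "degree f \<le> m" "u = vec (m + 1) (coeff f)" using obtain_coeffs[OF u] .
  show thesis
  proof (rule that)
    show "coeff f i = 0" if "i \<ge> n" for i using that f Suc by (intro coeff_eq_0) auto
    show "riesz \<gamma> (f * monom 1 j) = c j" if "j < n" for j
      using hankel_mult_coeffs[OF f(1), of j \<gamma>] arg_cong[OF Hu, of "\<lambda>v. v $ j"] that Suc
      unfolding f(2) by (simp del: index_mult_mat_vec)
  qed
qed

text \<open>The combination \<open>w\<close> of the border criterion is read as the coefficients of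
  \<open>f\<close>. The exponent \<open>e\<close> is kept free: \<open>e = h + 1\<close> yields the
  next Hankel matrix and \<open>e = h + 2\<close> the matrix \<open>A_tilde\<close>.\<close>

lemma rank_hankel_border_iff:
  fixes \<gamma> :: "nat \<Rightarrow> real" and h e :: nat
  defines "B \<equiv> (let v = mat_of_row (vec (h + 1) (\<lambda>i. \<gamma> (e + i))) in
      four_block_mat (hankel h \<gamma>) (transpose_mat v) v (mat 1 1 (\<lambda>_. \<gamma> (2 * e))))"
  shows "mat_rank (hankel h \<gamma>) = mat_rank B \<longleftrightarrow>
    (\<exists>f. degree f \<le> h \<and> (\<forall>j\<le>h. riesz \<gamma> (f * monom 1 j) = \<gamma> (e + j)) \<and>
         riesz \<gamma> (f * monom 1 e) = \<gamma> (2 * e))"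
proof -
  let ?b = "vec (h + 1) (\<lambda>i. \<gamma> (e + i))"
  have dim: "dim_row B = h + 1 + 1" by (simp add: B_def Let_def mat_of_row_def)
  have "mat_rank (hankel h \<gamma>) = mat_rank B \<longleftrightarrow>
    (\<exists>w \<in> carrier_vec (h + 1). hankel h \<gamma> *\<^sub>v w = ?b \<and> scalar_prod ?b w = \<gamma> (2 * e))"
    unfolding dim dim_hankel unfolding B_def Let_def
    by (rule rank_border_iff[OF hankel_carrier transpose_hankel vec_carrier])
  also have "\<dots> \<longleftrightarrow> (\<exists>f. degree f \<le> h \<and> hankel h \<gamma> *\<^sub>v vec (h + 1) (coeff f) = ?b \<and>
      scalar_prod ?b (vec (h + 1) (coeff f)) = \<gamma> (2 * e))"
    using obtain_coeffs by (metis vec_carrier)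
  also have "\<dots> \<longleftrightarrow> (\<exists>f. degree f \<le> h \<and> (\<forall>j\<le>h. riesz \<gamma> (f * monom 1 j) = \<gamma> (e + j)) \<and>
         riesz \<gamma> (f * monom 1 e) = \<gamma> (2 * e))"
  proof (intro ex_cong1 conj_cong refl)
    fix f :: "real poly" assume f: "degree f \<le> h"
    show "hankel h \<gamma> *\<^sub>v vec (h + 1) (coeff f) = ?b \<longleftrightarrow> (\<forall>j\<le>h. riesz \<gamma> (f * monom 1 j) = \<gamma> (e + j))"
      using hankel_mult_coeffs[OF f] by (auto simp: vec_eq_iff less_Suc_eq_le simp del: index_mult_mat_vec)
    have "scalar_prod ?b (vec (h + 1) (coeff f)) = riesz \<gamma> (f * monom 1 e)"
      unfolding riesz_mult_monom[OF f]
      by (auto simp: scalar_prod_def atLeast0LessThan lessThan_Suc_atMost add.commute mult.commute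
          intro!: sum.cong simp del: sum.lessThan_Suc sum.atMost_Suc)
    then show "scalar_prod ?b (vec (h + 1) (coeff f)) = \<gamma> (2 * e) \<longleftrightarrow> riesz \<gamma> (f * monom 1 e) = \<gamma> (2 * e)"
      by simp
  qed
  finally show ?thesis .
qed

lemma hankel_Suc_eq_border:
  "hankel (Suc h) \<gamma> = (let v = mat_of_row (vec (h + 1) (\<lambda>i. \<gamma> (Suc h + i))) in
      four_block_mat (hankel h \<gamma>) (transpose_mat v) v (mat 1 1 (\<lambda>_. \<gamma> (2 * Suc h))))"
proof -
  define v where "v = mat_of_row (vec (h + 1) (\<lambda>i. \<gamma> (Suc h + i)))"
  have v: "v \<in> carrier_mat 1 (h + 1)" by (simp add: v_def mat_of_row_def)
  have vi: "v $$ (0, i) = \<gamma> (Suc h + i)" if "i \<le> h" for i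
    using that by (simp add: v_def mat_of_row_def)
  have "hankel (Suc h) \<gamma> = four_block_mat (hankel h \<gamma>) (transpose_mat v) v (mat 1 1 (\<lambda>_. \<gamma> (2 * Suc h)))"
    (is "_ = ?R")
  proof (rule eq_matI)
    fix i j assume "i < dim_row ?R" "j < dim_col ?R"
    then have ij: "i \<le> Suc h" "j \<le> Suc h" using v by auto
    then show "hankel (Suc h) \<gamma> $$ (i, j) = ?R $$ (i, j)"
      using v vi by (cases "i = Suc h"; cases "j = Suc h") (simp_all add: add.commute mult_2)
  qed (use v in simp_all)
  then show ?thesis by (simp add: v_def Let_def)
qed

text \<open>A relation expressing column \<open>i\<close> by the earlier ones is a monic kernel
  polynomial of degree \<open>i\<close>, whose lower coefficients are those of the relation with the
  sign changed.\<close>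

lemma col_hankel_in_vspan_iff:
  assumes i: "i \<le> m"
  shows "col (hankel m \<gamma>) i \<in> vspan (m + 1) (col (hankel m \<gamma>) ` {..<i}) \<longleftrightarrow>
    (\<exists>p. degree p = i \<and> lead_coeff p = 1 \<and> (\<forall>j\<le>m. riesz \<gamma> (p * monom 1 j) = 0))"
proof -
  have "col (hankel m \<gamma>) i \<in> vspan (m + 1) (col (hankel m \<gamma>) ` {..<i}) \<longleftrightarrow>
      (\<exists>c. \<forall>j<m + 1. col (hankel m \<gamma>) i $ j = (\<Sum>l<i. hankel m \<gamma> $$ (j, l) * c l))"
    using i by (intro col_in_vspan_iff[OF hankel_carrier] col_carrier_vec[OF _ hankel_carrier]) auto
  also have "\<dots> \<longleftrightarrow> (\<exists>c. \<forall>j\<le>m. \<gamma> (i + j) = (\<Sum>l<i. c l * \<gamma> (l + j)))"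
    using i by (intro ex_cong1 all_cong1) (auto simp: less_Suc_eq_le add.commute mult.commute intro!: sum.cong)
  also have "\<dots> \<longleftrightarrow> (\<exists>p. degree p = i \<and> lead_coeff p = 1 \<and> (\<forall>j\<le>m. riesz \<gamma> (p * monom 1 j) = 0))"
  proof
    assume "\<exists>c. \<forall>j\<le>m. \<gamma> (i + j) = (\<Sum>l<i. c l * \<gamma> (l + j))"
    then obtain c where c: "\<And>j. j \<le> m \<Longrightarrow> \<gamma> (i + j) = (\<Sum>l<i. c l * \<gamma> (l + j))" by blast
    define p where "p = monom 1 i - (\<Sum>l<i. monom (c l) l)"
    have co: "coeff p n = (if n = i then 1 else if n < i then - c n else 0)" for n
      by (auto simp: p_def coeff_sum)
    have "degree p = i"
      by (intro antisym degree_le le_degree) (auto simp: co)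
    moreover have "riesz \<gamma> (p * monom 1 j) = 0" if "j \<le> m" for j
      using c[OF that] \<open>degree p = i\<close>
      by (simp add: riesz_mult_monom[of p i] co sum_negf flip: lessThan_Suc_atMost)
    ultimately show "\<exists>p. degree p = i \<and> lead_coeff p = 1 \<and> (\<forall>j\<le>m. riesz \<gamma> (p * monom 1 j) = 0)"
      using co by auto
  next
    assume "\<exists>p. degree p = i \<and> lead_coeff p = 1 \<and> (\<forall>j\<le>m. riesz \<gamma> (p * monom 1 j) = 0)"
    then obtain p where p: "degree p = i" "coeff p i = 1" "\<And>j. j \<le> m \<Longrightarrow> riesz \<gamma> (p * monom 1 j) = 0"
      by auto
    have "\<gamma> (i + j) = (\<Sum>l<i. - coeff p l * \<gamma> (l + j))" if "j \<le> m" for j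
      using p(3)[OF that] p(1,2)
      by (simp add: riesz_mult_monom[of p i] sum_negf flip: lessThan_Suc_atMost)
    then show "\<exists>c. \<forall>j\<le>m. \<gamma> (i + j) = (\<Sum>l<i. c l * \<gamma> (l + j))"
      by (intro exI[of _ "\<lambda>l. - coeff p l"]) blast
  qed
  finally show ?thesis .
qed

lemma seq_rank_pd:
  assumes "pd (hankel m \<gamma>)"
  shows "seq_rank m \<gamma> = m + 1"
proof -
  obtain B where "B \<in> carrier_mat (m + 1) (m + 1)" "hankel m \<gamma> * B = 1\<^sub>m (m + 1)" "B * hankel m \<gamma> = 1\<^sub>m (m + 1)"
    using det_nonzero_imp_invertible_mat[OF hankel_carrier pd_hankel_det[OF assms]] by blast
  then have "invertible_mat (hankel m \<gamma>)"
    unfolding invertible_mat_def inverts_mat_def by (intro conjI exI[of _ B]) auto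
  then show ?thesis by (simp add: seq_rank_def)
qed

text \<open>A nonzero polynomial whose square has value 0 lies in the kernel, so its degree marks a
  dependent column. The first dependent column yields \<open>p\<close>, and minimality of its index
  excludes such polynomials of smaller degree.\<close>

lemma seq_rank_psd_singular:
  assumes psd: "psd (hankel m \<gamma>)" and npd: "\<not> pd (hankel m \<gamma>)"
  obtains p where "degree p = seq_rank m \<gamma>" "seq_rank m \<gamma> \<le> m" "p \<noteq> 0"
    "\<And>j. j \<le> m \<Longrightarrow> riesz \<gamma> (p * monom 1 j) = 0"
    "\<And>q. q \<noteq> 0 \<Longrightarrow> degree q < seq_rank m \<gamma> \<Longrightarrow> 0 < riesz \<gamma> (q * q)"
proof -
  define K where "K = {i. i \<le> m \<and> col (hankel m \<gamma>) i \<in> vspan (m + 1) (col (hankel m \<gamma>) ` {..<i})}"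
  have degree_in_K: "degree p \<in> K" if p: "p \<noteq> 0" "degree p \<le> m" "riesz \<gamma> (p * p) = 0" for p
  proof -
    define q where "q = Polynomial.smult (1 / lead_coeff p) p"
    have "riesz \<gamma> (q * monom 1 j) = 0" if "j \<le> m" for j
      using psd_hankel_kernel[OF psd p(2,3), of "monom 1 j"] that degree_monom_le[of "1 :: real" j]
      by (simp add: q_def)
    moreover have "degree q = degree p" "lead_coeff q = 1" using p(1) by (auto simp: q_def)
    ultimately show ?thesis unfolding K_def using p(2) col_hankel_in_vspan_iff[OF p(2)] by auto
  qed
  obtain p0 where p0: "p0 \<noteq> 0" "degree p0 \<le> m" "riesz \<gamma> (p0 * p0) \<le> 0"
    using npd pd_hankel_iff[of m \<gamma>] by (auto simp: not_less)
  then have p00: "riesz \<gamma> (p0 * p0) = 0" using psd psd_hankel_iff by (metis antisym)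
  have finK: "finite K" by (rule finite_subset[of _ "{..m}"]) (auto simp: K_def)
  have "K \<noteq> {}" using degree_in_K[OF p0(1,2) p00] by auto
  \<comment> \<open>A nonzero kernel vector excludes an inverse, so \<open>seq_rank\<close> is the
    minimum of \<open>K\<close>.\<close>
  have "\<not> invertible_mat (hankel m \<gamma>)"
  proof
    assume "invertible_mat (hankel m \<gamma>)"
    then obtain B where B: "B * hankel m \<gamma> = 1\<^sub>m (dim_row B)" "hankel m \<gamma> * B = 1\<^sub>m (m + 1)"
      unfolding invertible_mat_def inverts_mat_def by auto
    \<comment> \<open>\<open>invertible_mat\<close> does not prescribe the shape of the inverse; it
      is read off from the two products.\<close>
    have "dim_col B = m + 1" using arg_cong[OF B(2), of dim_col] by simp
    moreover have "dim_row B = m + 1" using arg_cong[OF B(1), of dim_col] by simp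
    ultimately have Bc: "B \<in> carrier_mat (m + 1) (m + 1)" by auto
    let ?u = "vec (m + 1) (coeff p0)"
    have "hankel m \<gamma> *\<^sub>v ?u = 0\<^sub>v (m + 1)"
    proof (intro eq_vecI)
      fix j assume "j < dim_vec (0\<^sub>v (m + 1) :: real vec)"
      then show "(hankel m \<gamma> *\<^sub>v ?u) $ j = 0\<^sub>v (m + 1) $ j"
        using hankel_mult_coeffs[OF p0(2), of j \<gamma>]
          psd_hankel_kernel[OF psd p0(2) p00, of "monom 1 j"] degree_monom_le[of "1 :: real" j]
        by (simp del: index_mult_mat_vec)
    qed simp
    then have "B *\<^sub>v (hankel m \<gamma> *\<^sub>v ?u) = 0\<^sub>v (m + 1)" using Bc by (auto intro!: eq_vecI)
    then have "?u = 0\<^sub>v (m + 1)"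
      using assoc_mult_mat_vec[OF Bc hankel_carrier[of m \<gamma>] vec_carrier[of "m + 1" "coeff p0"]] B(1) Bc
      by simp
    then show False using vec_coeff_eq_0_iff[OF p0(2)] p0(1) by simp
  qed
  then have sr: "seq_rank m \<gamma> = Min K" by (simp add: seq_rank_def K_def Let_def)
  have "Min K \<in> K" using finK \<open>K \<noteq> {}\<close> by simp
  then have "Min K \<le> m" and
    "\<exists>p. degree p = Min K \<and> lead_coeff p = 1 \<and> (\<forall>j\<le>m. riesz \<gamma> (p * monom 1 j) = 0)"
    using col_hankel_in_vspan_iff unfolding K_def by auto
  then obtain p where p: "degree p = Min K" "lead_coeff p = 1" "\<And>j. j \<le> m \<Longrightarrow> riesz \<gamma> (p * monom 1 j) = 0"
    by blast
  show thesis
  proof (rule that)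
    show "0 < riesz \<gamma> (q * q)" if "q \<noteq> 0" "degree q < seq_rank m \<gamma>" for q
    proof (rule ccontr)
      assume "\<not> 0 < riesz \<gamma> (q * q)"
      moreover have dq: "degree q \<le> m" using that(2) sr \<open>Min K \<le> m\<close> by simp
      ultimately have "riesz \<gamma> (q * q) = 0" using psd psd_hankel_iff by (metis antisym not_less)
      then have "degree q \<in> K" using degree_in_K that(1) dq by blast
      then have "Min K \<le> degree q" by (rule Min_le[OF finK])
      then show False using that(2) sr by simp
    qed
  qed (use p sr \<open>Min K \<le> m\<close> in auto)
qed

section \<open>Completion and measures\<close>

text \<open>\<open>pick I\<close> enumerates \<open>I\<close>, so a vector on the submatrix is a
  polynomial with exponents in \<open>I\<close>, and the quadratic form is the functional applied to
  its square.\<close>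

lemma psd_map_submatrix_iff:
  assumes I: "I \<subseteq> {..k}" and spec: "\<And>i j. i \<in> I \<Longrightarrow> j \<in> I \<Longrightarrow> G (i + j) = Some (\<beta> (i + j))"
  shows "psd (map_mat the (submatrix (hankel k G) I I)) \<longleftrightarrow>
    (\<forall>p. (\<forall>i. coeff p i \<noteq> 0 \<longrightarrow> i \<in> I) \<longrightarrow> 0 \<le> riesz \<beta> (p * p))"
proof -
  define A where "A = map_mat the (submatrix (hankel k G) I I)"
  have finI: "finite I" using I finite_subset by blast
  have "{i. i < k + 1 \<and> i \<in> I} = I" using I by auto
  then have dim: "dim_row (submatrix (hankel k G) I I) = card I" "dim_col (submatrix (hankel k G) I I) = card I"
    by (simp_all add: dim_submatrix)
  have A: "A \<in> carrier_mat (card I) (card I)" using dim unfolding A_def by auto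
  have pickI: "pick I a \<in> I" if "a < card I" for a using pick_in_set_le[OF that] .
  have idx: "A $$ (a, b) = \<beta> (pick I a + pick I b)" if "a < card I" "b < card I" for a b
  proof -
    have "submatrix (hankel k G) I I $$ (a, b) = hankel k G $$ (pick I a, pick I b)"
      using that dim by (intro submatrix_index) (simp_all add: dim_submatrix)
    also have "\<dots> = Some (\<beta> (pick I a + pick I b))"
      using pickI[OF that(1)] pickI[OF that(2)] I spec by (subst hankel_index) auto
    finally show ?thesis using that dim unfolding A_def by simp
  qed
  have bij: "bij_betw (pick I) {..<card I} I"
  proof -
    have "inj_on (pick I) {..<card I}"
      by (rule inj_onI) (metis lessThan_iff linorder_neqE_nat nat_less_le pick_mono_le)
    moreover have "pick I ` {..<card I} \<subseteq> I" using pickI by auto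
    ultimately show ?thesis
      using card_subset_eq[OF finI, of "pick I ` {..<card I}"] unfolding bij_betw_def
      by (simp add: card_image)
  qed
  define P where "P u = (\<Sum>a<card I. monom (u $ a) (pick I a))" for u :: "real vec"
  have form: "scalar_prod u (A *\<^sub>v u) = riesz \<beta> (P u * P u)" if u: "u \<in> carrier_vec (card I)" for u
  proof -
    have "riesz \<beta> (P u * P u) = (\<Sum>a<card I. \<Sum>b<card I. u $ a * u $ b * \<beta> (pick I a + pick I b))"
      by (simp add: P_def sum_product mult_monom riesz_sum riesz_monom')
    also have "\<dots> = scalar_prod u (A *\<^sub>v u)"
      using u A idx by (auto simp: scalar_prod_def atLeast0LessThan sum_distrib_left mult_ac intro!: sum.cong)
    finally show ?thesis ..
  qed
  have "transpose_mat A = A"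
    using A idx by (intro eq_matI) (auto simp: add.commute)
  then have "psd A \<longleftrightarrow> (\<forall>u \<in> carrier_vec (card I). 0 \<le> riesz \<beta> (P u * P u))"
    using A form by (auto simp: psd_def)
  also have "\<dots> \<longleftrightarrow> (\<forall>p. (\<forall>i. coeff p i \<noteq> 0 \<longrightarrow> i \<in> I) \<longrightarrow> 0 \<le> riesz \<beta> (p * p))"
  proof safe
    fix p :: "real poly" assume all: "\<forall>u \<in> carrier_vec (card I). 0 \<le> riesz \<beta> (P u * P u)"
      and p: "\<forall>i. coeff p i \<noteq> 0 \<longrightarrow> i \<in> I"
    have "P (vec (card I) (\<lambda>a. coeff p (pick I a))) = (\<Sum>a<card I. monom (coeff p (pick I a)) (pick I a))"
      by (auto simp: P_def intro!: sum.cong)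
    also have "\<dots> = (\<Sum>i\<in>I. monom (coeff p i) i)"
      by (rule sum.reindex_bij_betw[OF bij])
    also have "\<dots> = p"
      using p finI by (intro poly_eqI) (auto simp: coeff_sum)
    finally show "0 \<le> riesz \<beta> (p * p)" using all by (metis vec_carrier)
  next
    fix u assume all: "\<forall>p. (\<forall>i. coeff p i \<noteq> 0 \<longrightarrow> i \<in> I) \<longrightarrow> 0 \<le> riesz \<beta> (p * p)"
    have "i \<in> I" if "coeff (P u) i \<noteq> 0" for i
    proof (rule ccontr)
      assume "i \<notin> I"
      then have "coeff (P u) i = 0"
        using pickI by (auto simp: P_def coeff_sum intro!: sum.neutral)
      then show False using that by simp
    qed
    then show "0 \<le> riesz \<beta> (P u * P u)" using all by blast
  qed
  finally show ?thesis unfolding A_def .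
qed

text \<open>Only the positions \<open>(k - 1, k)\<close> and \<open>(k, k - 1)\<close> are
  unspecified, so the fully specified principal submatrices are those whose index set misses
  \<open>k - 1\<close> or \<open>k\<close>.\<close>

lemma partially_psd_unspecified_iff:
  assumes k: "k \<ge> 1"
  shows "partially_psd (hankel k (unspecified k \<beta>)) \<longleftrightarrow>
    (\<forall>p. degree p \<le> k \<and> (coeff p (k - 1) = 0 \<or> coeff p k = 0) \<longrightarrow> 0 \<le> riesz \<beta> (p * p))"
proof -
  let ?A = "hankel k (unspecified k \<beta>)"
  have sym: "transpose_mat ?A = ?A"
    by (intro eq_matI) (auto simp: hankel_def add.commute)
  have spec: "(\<forall>i \<in> I. \<forall>j \<in> I. ?A $$ (i, j) \<noteq> None) \<longleftrightarrow> k - 1 \<notin> I \<or> k \<notin> I" if I: "I \<subseteq> {..k}" for I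
  proof
    assume *: "\<forall>i \<in> I. \<forall>j \<in> I. ?A $$ (i, j) \<noteq> None"
    have "?A $$ (k - 1, k) = None"
      using k by (subst hankel_index) (auto simp: unspecified_def)
    then show "k - 1 \<notin> I \<or> k \<notin> I" using * by blast
  next
    assume *: "k - 1 \<notin> I \<or> k \<notin> I"
    show "\<forall>i \<in> I. \<forall>j \<in> I. ?A $$ (i, j) \<noteq> None"
    proof (intro ballI)
      fix i j assume ij: "i \<in> I" "j \<in> I"
      then have "i \<le> k" "j \<le> k" using I by auto
      moreover have "i + j \<noteq> 2 * k - 1"
      proof
        assume "i + j = 2 * k - 1"
        then have "i = k - 1 \<and> j = k \<or> i = k \<and> j = k - 1" using \<open>i \<le> k\<close> \<open>j \<le> k\<close> k by linarith
        then show False using * ij by auto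
      qed
      ultimately show "?A $$ (i, j) \<noteq> None" by (simp add: unspecified_def)
    qed
  qed
  have iff: "psd (map_mat the (submatrix ?A I I)) \<longleftrightarrow>
      (\<forall>p. (\<forall>i. coeff p i \<noteq> 0 \<longrightarrow> i \<in> I) \<longrightarrow> 0 \<le> riesz \<beta> (p * p))"
    if I: "I \<subseteq> {..k}" "k - 1 \<notin> I \<or> k \<notin> I" for I
  proof (rule psd_map_submatrix_iff[OF I(1)])
    fix i j assume ij: "i \<in> I" "j \<in> I"
    then have "?A $$ (i, j) \<noteq> None" using spec[OF I(1)] I(2) by blast
    moreover have "i \<le> k" "j \<le> k" using ij I(1) by auto
    ultimately show "unspecified k \<beta> (i + j) = Some (\<beta> (i + j))"
      by (auto simp: unspecified_def split: if_splits)
  qed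
  have "partially_psd ?A \<longleftrightarrow> (\<forall>I \<subseteq> {..k}. k - 1 \<notin> I \<or> k \<notin> I \<longrightarrow> psd (map_mat the (submatrix ?A I I)))"
    unfolding partially_psd_def using sym spec by (simp add: lessThan_Suc_atMost)
  also have "\<dots> \<longleftrightarrow> (\<forall>p. degree p \<le> k \<and> (coeff p (k - 1) = 0 \<or> coeff p k = 0) \<longrightarrow> 0 \<le> riesz \<beta> (p * p))"
  proof (intro iffI allI impI)
    fix p :: "real poly"
    assume *: "\<forall>I \<subseteq> {..k}. k - 1 \<notin> I \<or> k \<notin> I \<longrightarrow> psd (map_mat the (submatrix ?A I I))"
      and "degree p \<le> k \<and> (coeff p (k - 1) = 0 \<or> coeff p k = 0)"
    then have p: "degree p \<le> k" and c: "coeff p (k - 1) = 0 \<or> coeff p k = 0" by blast+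
    \<comment> \<open>The support of \<open>p\<close> is the index set whose submatrix tests
      \<open>p\<close>.\<close>
    let ?I = "{i. coeff p i \<noteq> 0}"
    have I: "?I \<subseteq> {..k}" using p le_degree le_trans by blast
    have ck: "k - 1 \<notin> ?I \<or> k \<notin> ?I" using c by auto
    have "psd (map_mat the (submatrix ?A ?I ?I))" using * I ck by blast
    then show "0 \<le> riesz \<beta> (p * p)" using iff[OF I ck] by blast
  next
    fix I assume *: "\<forall>p. degree p \<le> k \<and> (coeff p (k - 1) = 0 \<or> coeff p k = 0) \<longrightarrow> 0 \<le> riesz \<beta> (p * p)"
      and I: "I \<subseteq> {..k}" and ck: "k - 1 \<notin> I \<or> k \<notin> I"
    have "0 \<le> riesz \<beta> (p * p)" if p: "\<forall>i. coeff p i \<noteq> 0 \<longrightarrow> i \<in> I" for p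
    proof -
      have "degree p \<le> k" using p I by (intro degree_le) (auto simp: subset_iff not_le)
      moreover have "coeff p (k - 1) = 0 \<or> coeff p k = 0" using p ck by blast
      ultimately show ?thesis using * by blast
    qed
    then show "psd (map_mat the (submatrix ?A I I))" using iff[OF I ck] by blast
  qed
  finally show ?thesis .
qed

section \<open>The free moment and its choice\<close>

lemma riesz_completed_square:
  assumes k: "k \<ge> 1" and p: "degree p \<le> k" "coeff p (k - 1) = 0 \<or> coeff p k = 0"
  shows "riesz (completed k \<beta> x) (p * p) = riesz \<beta> (p * p)"
  unfolding riesz_mult_double_sum[OF p(1) p(1)]
proof (intro sum.cong refl)
  fix i j assume ij: "i \<in> {..k}" "j \<in> {..k}"
  show "coeff p i * coeff p j * completed k \<beta> x (i + j) = coeff p i * coeff p j * \<beta> (i + j)"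
  proof (cases "i + j = 2 * k - 1")
    \<comment> \<open>Only these two pairs of indices meet the free moment, and one of the two
      coefficients vanishes.\<close>
    case True
    then have "i = k - 1 \<and> j = k \<or> i = k \<and> j = k - 1" using ij k by auto
    then show ?thesis using p(2) by auto
  qed (simp add: completed_def)
qed

lemma riesz_completed:
  assumes "degree p \<le> 2 * k - 1"
  shows "riesz (completed k \<beta> x) p = riesz (completed k \<beta> 0) p + x * coeff p (2 * k - 1)"
  unfolding riesz_altdef[OF assms]
  by (cases "2 * k - 1") (simp_all add: completed_def algebra_simps)

lemma riesz_completed_low:
  assumes "degree p < 2 * k - 1"
  shows "riesz (completed k \<beta> x) p = riesz \<beta> p"
  by (rule riesz_cong[of p "2 * k - 2"]) (use assms in \<open>auto simp: completed_def\<close>)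

text \<open>The free moment is chosen such that \<open>t\<^sup>k\<close>, projected away from the polynomials of degree at
  most \<open>k - 2\<close> and corrected by a multiple of the orthogonal polynomial of degree \<open>k - 1\<close>, has
  norm \<open>0\<close>.\<close>

lemma flat_completion:
  assumes k: "k \<ge> 1"
    and pd: "\<And>q. q \<noteq> 0 \<Longrightarrow> degree q < k \<Longrightarrow> 0 < riesz \<beta> (q * q)"
    and psd: "\<And>p. degree p \<le> k \<Longrightarrow> coeff p (k - 1) = 0 \<Longrightarrow> 0 \<le> riesz \<beta> (p * p)"
  obtains x p where "degree p = k" "\<And>j. j \<le> k \<Longrightarrow> riesz (completed k \<beta> x) (p * monom 1 j) = 0"
proof -
  have pd': "0 < riesz \<beta> (q * q)" if "q \<noteq> 0" "degree q < k - 1" for q using pd that by auto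
  obtain q where q: "\<And>i. i \<ge> k - 1 \<Longrightarrow> coeff q i = 0"
      "\<And>j. j < k - 1 \<Longrightarrow> riesz \<beta> (q * monom 1 j) = \<beta> (k + j)"
    using pd_riesz_solve[OF pd', where c = "\<lambda>j. \<beta> (k + j)"] by blast
  obtain q' where q': "\<And>i. i \<ge> k - 1 \<Longrightarrow> coeff q' i = 0"
      "\<And>j. j < k - 1 \<Longrightarrow> riesz \<beta> (q' * monom 1 j) = \<beta> (k - 1 + j)"
    using pd_riesz_solve[OF pd', where c = "\<lambda>j. \<beta> (k - 1 + j)"] by blast
  \<comment> \<open>\<open>f\<close> and \<open>r\<close> are \<open>t^k\<close> and
    \<open>t^(k - 1)\<close> projected away from the degrees below \<open>k - 1\<close>; for
    \<open>k = 1\<close> both corrections are zero. As \<open>f\<close> has no term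
    \<open>t^(k - 1)\<close>, its square does not involve the free moment.\<close>
  define f where "f = monom 1 k - q"
  define r where "r = monom 1 (k - 1) - q'"
  have cf: "coeff f k = 1" "coeff f (k - 1) = 0" "\<And>i. i > k \<Longrightarrow> coeff f i = 0"
    using q(1) k by (auto simp: f_def)
  have cr: "coeff r (k - 1) = 1" "\<And>i. i > k - 1 \<Longrightarrow> coeff r i = 0"
    using q'(1) by (auto simp: r_def)
  have df: "degree f = k" using cf by (intro antisym degree_le le_degree) auto
  have dr: "degree r = k - 1" using cr by (intro antisym degree_le le_degree) auto
  have forth: "riesz \<beta> (f * monom 1 j) = 0" if "j < k - 1" for j
    using q(2)[OF that] by (simp add: f_def left_diff_distrib mult_monom)
  have rorth: "riesz \<beta> (r * monom 1 j) = 0" if "j < k - 1" for j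
    using q'(2)[OF that] by (simp add: r_def left_diff_distrib mult_monom)
  define h where "h = riesz \<beta> (r * r)"
  have h: "h > 0" unfolding h_def using cr(1) dr k by (intro pd) auto
  define e where "e = riesz \<beta> (f * f)"
  have e: "e \<ge> 0" unfolding e_def using df cf by (intro psd) auto
  \<comment> \<open>If \<open>f * f\<close>, \<open>r * r\<close> and \<open>f * r\<close> have the
    values \<open>e\<close>, \<open>h\<close> and \<open>c * h\<close>, then \<open>f - c r\<close>
    is orthogonal to \<open>r\<close> and its square has value \<open>e - c^2 h = 0\<close>.\<close>
  define c where "c = sqrt (e / h)"
  have c2: "c * c * h = e" using e h by (simp add: c_def)
  \<comment> \<open>The product \<open>f * r\<close> is monic of degree \<open>2 k - 1\<close>, so
    the free moment enters its value with coefficient 1 and can bring it to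
    \<open>c * h\<close>.\<close>
  define x where "x = c * h - riesz (completed k \<beta> 0) (f * r)"
  let ?\<gamma> = "completed k \<beta> x"
  have dfr: "degree f + degree r = 2 * k - 1" using df dr k by simp
  have "coeff (f * r) (2 * k - 1) = 1"
    using coeff_mult_degree_sum[of f r] cf(1) cr(1) df dr unfolding dfr by simp
  then have fr: "riesz ?\<gamma> (f * r) = c * h"
    using riesz_completed[of "f * r" k \<beta> x] degree_mult_le[of f r] dfr by (simp add: x_def)
  have ff: "riesz ?\<gamma> (f * f) = e"
    unfolding e_def using df cf k by (intro riesz_completed_square) auto
  have rr: "riesz ?\<gamma> (r * r) = h"
    unfolding h_def using dr cr k by (intro riesz_completed_square) auto
  define p where "p = f - Polynomial.smult c r"
  have "degree p = k"
    using cf(1,3) cr(2) k by (intro antisym degree_le le_degree) (auto simp: p_def)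
  have low: "riesz ?\<gamma> (p * monom 1 j) = 0" if j: "j < k - 1" for j
  proof -
    have "degree (f * monom 1 j) < 2 * k - 1" "degree (r * monom 1 j) < 2 * k - 1"
      using degree_mult_le[of f "monom 1 j"] degree_mult_le[of r "monom 1 j"]
        degree_monom_le[of "1 :: real" j] df dr j by linarith+
    then show ?thesis
      using forth[OF j] rorth[OF j]
      by (simp add: p_def left_diff_distrib riesz_completed_low)
  qed
  have lowmult: "riesz ?\<gamma> (p * g) = 0" if g: "\<And>i. i \<ge> k - 1 \<Longrightarrow> coeff g i = 0" for g :: "real poly"
    unfolding riesz_mult[of g "degree g", OF order_refl] using g low by (intro sum.neutral) (metis mult_eq_0_iff not_less)
  have pr: "riesz ?\<gamma> (p * r) = 0" using fr rr by (simp add: p_def left_diff_distrib)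
  have pp: "riesz ?\<gamma> (p * p) = 0"
  proof -
    have "p * p = p * f - Polynomial.smult c (p * r)" by (simp add: p_def right_diff_distrib)
    then have "riesz ?\<gamma> (p * p) = riesz ?\<gamma> (p * f)" using pr by simp
    also have "p * f = f * f - Polynomial.smult c (f * r)"
      by (simp add: p_def left_diff_distrib mult.commute[of r f])
    also have "riesz ?\<gamma> \<dots> = 0" using ff fr c2 by simp
    finally show ?thesis .
  qed
  \<comment> \<open>Up to terms of degree below \<open>k - 1\<close>, the power
    \<open>t^(k - 1)\<close> is \<open>r\<close> and \<open>t^k\<close> is \<open>p + c r\<close>,
    so \<open>pr\<close>, \<open>pp\<close> and \<open>lowmult\<close> suffice.\<close>
  have "riesz ?\<gamma> (p * monom 1 j) = 0" if "j \<le> k" for j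
  proof -
    consider "j < k - 1" | "j = k - 1" | "j = k" using \<open>j \<le> k\<close> by linarith
    then show ?thesis
    proof cases
      case 2
      have "p * monom 1 j = p * r + p * q'" using 2 by (simp add: r_def right_diff_distrib)
      then show ?thesis using pr lowmult[OF q'(1)] by simp
    next
      case 3
      have "monom 1 j = p + Polynomial.smult c r + q" using 3 by (simp add: p_def f_def)
      then have "p * monom 1 j = p * p + Polynomial.smult c (p * r) + p * q"
        by (simp add: distrib_left)
      then show ?thesis using pp pr lowmult[OF q(1)] by simp
    qed (rule low)
  qed
  then show thesis using that \<open>degree p = k\<close> by blast
qed

section \<open>Atomic measures and integrals of polynomials\<close>

lemma ex_atomic_representing_measure:
  assumes S: "finite S" and w: "\<And>a. a \<in> S \<Longrightarrow> 0 < w a"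
    and moments: "\<And>i. i \<le> 2 * m \<Longrightarrow> \<gamma> i = (\<Sum>a\<in>S. w a * a ^ i)"
  shows "\<exists>\<mu>. representing_measure m \<gamma> \<mu> \<and> atomic (card S) \<mu>"
proof -
  \<comment> \<open>The point measure has \<open>S\<close> as its whole space; pushing it forward
    along the identity makes it a Borel measure on the line.\<close>
  define \<nu> where "\<nu> = point_measure S (\<lambda>a. ennreal (w a))"
  define \<mu> where "\<mu> = distr \<nu> borel (\<lambda>a. a :: real)"
  have meas: "(\<lambda>a. a :: real) \<in> measurable \<nu> borel"
    by (simp add: \<nu>_def measurable_point_measure_eq1)
  have int: "integrable \<nu> (f :: real \<Rightarrow> real)" for f
    unfolding \<nu>_def by (rule integrable_point_measure_finite[OF S])
  have "integrable \<mu> (\<lambda>t. t ^ i)" for i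
    unfolding \<mu>_def by (subst integrable_distr_eq[OF meas]) (auto intro: int)
  moreover have "(\<integral>t. t ^ i \<partial>\<mu>) = (\<Sum>a\<in>S. w a * a ^ i)" for i
  proof -
    have "(\<integral>t. t ^ i \<partial>\<mu>) = (\<integral>a. a ^ i \<partial>\<nu>)"
      unfolding \<mu>_def by (rule integral_distr[OF meas]) simp
    also have "\<dots> = (\<Sum>a\<in>S. w a * a ^ i)"
      unfolding \<nu>_def using w by (subst lebesgue_integral_point_measure_finite[OF S]) (auto intro: less_imp_le)
    finally show ?thesis .
  qed
  ultimately have "representing_measure m \<gamma> \<mu>"
    using moments by (simp add: representing_measure_def \<mu>_def)
  moreover have "emeasure \<mu> B = (\<Sum>a\<in>S. ennreal (w a) * emeasure (return borel a) B)"
    if B: "B \<in> sets borel" for B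
  proof -
    have "emeasure \<mu> B = emeasure \<nu> (B \<inter> S)"
      unfolding \<mu>_def using emeasure_distr[OF meas B] by (simp add: \<nu>_def space_point_measure)
    also have "\<dots> = (\<Sum>a\<in>B \<inter> S. ennreal (w a))"
      unfolding \<nu>_def using S by (intro emeasure_point_measure_finite) auto
    also have "\<dots> = (\<Sum>a\<in>S. ennreal (w a) * emeasure (return borel a) B)"
      using S B by (intro sum.mono_neutral_cong_left) (auto simp: emeasure_return indicator_def)
    finally show ?thesis .
  qed
  then have "atomic (card S) \<mu>"
    unfolding atomic_def using S w
    by (intro conjI exI[of _ S] exI[of _ w]) (auto simp: \<mu>_def)
  ultimately show ?thesis by blast
qed

lemma representing_measure_riesz:
  assumes "representing_measure m \<gamma> \<mu>" and p: "degree p \<le> 2 * m"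
  shows "integrable \<mu> (poly p)" "riesz \<gamma> p = (\<integral>t. poly p t \<partial>\<mu>)"
proof -
  have i: "integrable \<mu> (\<lambda>t. t ^ i)" "\<gamma> i = (\<integral>t. t ^ i \<partial>\<mu>)" if "i \<le> 2 * m" for i
    using assms(1) that by (auto simp: representing_measure_def)
  have eq: "poly p = (\<lambda>t. \<Sum>i\<le>2 * m. coeff p i * t ^ i)"
    unfolding poly_altdef
    by (intro ext sum.mono_neutral_left) (use p in \<open>auto simp: coeff_eq_0\<close>)
  show "integrable \<mu> (poly p)" unfolding eq using i by auto
  show "riesz \<gamma> p = (\<integral>t. poly p t \<partial>\<mu>)"
    unfolding eq riesz_altdef[OF p] using i by (subst Bochner_Integration.integral_sum) auto
qed

section \<open>Necessity of the conditions\<close>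

lemma rank_conditions_iff:
  assumes k: "k > 1"
  shows "mat_rank (hankel (k - 2) \<beta>) = mat_rank (hankel (k - 1) \<beta>) \<longleftrightarrow>
      (\<exists>f. degree f \<le> k - 2 \<and> (\<forall>j\<le>k - 2. riesz \<beta> (f * monom 1 j) = \<beta> (k - 1 + j)) \<and>
         riesz \<beta> (f * monom 1 (k - 1)) = \<beta> (2 * (k - 1)))" (is ?hankel)
    and "mat_rank (hankel (k - 2) \<beta>) = mat_rank (A_tilde k \<beta>) \<longleftrightarrow>
      (\<exists>f. degree f \<le> k - 2 \<and> (\<forall>j\<le>k - 2. riesz \<beta> (f * monom 1 j) = \<beta> (k + j)) \<and>
         riesz \<beta> (f * monom 1 k) = \<beta> (2 * k))" (is ?A_tilde)
proof -
  \<comment> \<open>Both matrices border \<open>hankel h \<beta>\<close>, with exponents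
    \<open>k - 1\<close> and \<open>k\<close>. The second criterion skips the power
    \<open>t^(k - 1)\<close>, whose product with \<open>t^k\<close> would involve the free
    moment.\<close>
  define h where "h = k - 2"
  have k2: "k - 2 = h" "k - 1 = Suc h" "h + 1 = k - 1" using k by (auto simp: h_def)
  show ?hankel
    unfolding k2(1,2) hankel_Suc_eq_border[of h] by (rule rank_hankel_border_iff)
  show ?A_tilde
    unfolding A_tilde_def k2(1) k2(3)[symmetric] by (rule rank_hankel_border_iff)
qed

text \<open>Squares have nonnegative integrals. If one of degree at most \<open>2 k - 2\<close>
  integrates to 0 without being the zero polynomial, its root \<open>p\<close> vanishes almost
  everywhere, and so do all multiples of \<open>p\<close>. Subtracting suitable monic multiples from
  \<open>t^(k - 1)\<close> and \<open>t^k\<close> gives the polynomials that the rank criteria ask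
  for.\<close>

lemma representing_measure_imp_conditions:
  assumes k: "k \<ge> 1" and rep: "representing_measure k (completed k \<beta> x) \<mu>"
  shows "partially_psd (hankel k (unspecified k \<beta>))"
    and "k > 1 \<Longrightarrow> \<not> pd (hankel (k - 1) \<beta>) \<Longrightarrow>
      mat_rank (hankel (k - 2) \<beta>) = mat_rank (hankel (k - 1) \<beta>) \<and>
      mat_rank (hankel (k - 1) \<beta>) = mat_rank (A_tilde k \<beta>)"
proof -
  let ?\<gamma> = "completed k \<beta> x"
  have int: "integrable \<mu> (poly (p * p))" "riesz ?\<gamma> (p * p) = (\<integral>t. poly (p * p) t \<partial>\<mu>)"
    if "degree p \<le> k" for p
    using representing_measure_riesz[OF rep, of "p * p"] degree_mult_le[of p p] that by auto
  have nonneg: "0 \<le> riesz ?\<gamma> (p * p)" if "degree p \<le> k" for p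
    unfolding int(2)[OF that] by (intro integral_nonneg_AE) simp
  then show "partially_psd (hankel k (unspecified k \<beta>))"
    unfolding partially_psd_unspecified_iff[OF k] using riesz_completed_square[OF k] by metis
  assume k1: "k > 1" and "\<not> pd (hankel (k - 1) \<beta>)"
  then obtain p where p: "p \<noteq> 0" "degree p \<le> k - 1" "riesz \<beta> (p * p) \<le> 0"
    by (auto simp: pd_hankel_iff not_less)
  have dp: "degree p \<le> k" and "coeff p k = 0" using p(2) k by (auto intro: coeff_eq_0)
  then have "riesz ?\<gamma> (p * p) = 0"
    using nonneg[OF dp] riesz_completed_square[OF k dp, of \<beta> x] p(3) by simp
  then have "(\<integral>t. poly (p * p) t \<partial>\<mu>) = 0" unfolding int(2)[OF dp] .
  then have "AE t in \<mu>. poly (p * p) t = 0"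
    by (subst (asm) integral_nonneg_eq_0_iff_AE[OF int(1)[OF dp]]) simp_all
  then have AE_p: "AE t in \<mu>. poly p t = 0" by simp
  have kill: "riesz ?\<gamma> (g * p * u) = 0" if "degree (g * p * u) \<le> 2 * k" for g u
  proof -
    have "(\<integral>t. poly (g * p * u) t \<partial>\<mu>) = 0"
      by (rule integral_eq_zero_AE) (use AE_p in eventually_elim, simp)
    then show ?thesis using representing_measure_riesz(2)[OF rep that] by simp
  qed
  \<comment> \<open>The factor \<open>m\<close> makes \<open>q\<close> a monic multiple of
    \<open>p\<close> of degree exactly \<open>k - 1\<close>.\<close>
  define m where "m = Polynomial.smult (1 / lead_coeff p) (monom 1 (k - 1 - degree p))"
  define q where "q = m * p"
  have dq: "degree q = k - 1"
    unfolding q_def m_def using p(1,2) by (subst degree_mult_eq) (auto simp: degree_monom_eq)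
  have lq: "coeff q (k - 1) = 1"
  proof -
    have "lead_coeff q = lead_coeff m * lead_coeff p" unfolding q_def by (rule lead_coeff_mult)
    also have "\<dots> = 1" using p(1) by (simp add: m_def lead_coeff_smult degree_monom_eq)
    finally show ?thesis using dq by simp
  qed
  have q0: "riesz ?\<gamma> (q * monom 1 j) = 0" if "j \<le> k + 1" for j
    using kill[of m "monom 1 j"] degree_mult_le[of q "monom 1 j"] degree_monom_le[of "1 :: real" j] that dq k
    unfolding q_def by simp
  have rank1: "mat_rank (hankel (k - 2) \<beta>) = mat_rank (hankel (k - 1) \<beta>)"
    unfolding rank_conditions_iff(1)[OF k1]
  proof (intro exI conjI allI impI)
    let ?f = "monom 1 (k - 1) - q"
    have "coeff ?f i = 0" if "i > k - 2" for i
      using that dq lq coeff_eq_0[of q i] by (cases "i = k - 1") auto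
    then show df: "degree ?f \<le> k - 2" by (intro degree_le) auto
    have *: "riesz \<beta> (?f * monom 1 j) = \<beta> (k - 1 + j)" if "j \<le> k - 1" for j
    proof -
      have "degree (?f * monom 1 j) < 2 * k - 1"
        using degree_mult_le[of ?f "monom 1 j"] degree_monom_le[of "1 :: real" j] df that k1 by linarith
      then have "riesz \<beta> (?f * monom 1 j) = riesz ?\<gamma> (?f * monom 1 j)" by (simp add: riesz_completed_low)
      also have "\<dots> = ?\<gamma> (k - 1 + j)" using q0[of j] that by (simp add: left_diff_distrib mult_monom)
      also have "\<dots> = \<beta> (k - 1 + j)"
      proof -
        have "k - 1 + j \<noteq> 2 * k - 1" using that k1 by linarith
        then show ?thesis by (simp add: completed_def)
      qed
      finally show ?thesis .
    qed
    show "riesz \<beta> (?f * monom 1 j) = \<beta> (k - 1 + j)" if "j \<le> k - 2" for j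
      using that by (intro *) simp
    show "riesz \<beta> (?f * monom 1 (k - 1)) = \<beta> (2 * (k - 1))"
      using *[of "k - 1"] by (simp add: mult_2)
  qed
  have "mat_rank (hankel (k - 2) \<beta>) = mat_rank (A_tilde k \<beta>)"
    unfolding rank_conditions_iff(2)[OF k1]
  proof (intro exI conjI allI impI)
    \<comment> \<open>Subtracting a multiple of \<open>q\<close> from \<open>t q\<close> removes the
      term of degree \<open>k - 1\<close>, so that \<open>t^k - g\<close> has degree at most
      \<open>k - 2\<close>.\<close>
    define g where "g = [:- coeff q (k - 2), 1:] * q"
    have g: "coeff g i = (if i = k then 1 else 0)" if "i > k - 2" for i
    proof -
      obtain n where n: "i = Suc n" "n \<ge> k - 2" using \<open>i > k - 2\<close> by (cases i) auto
      have gi: "coeff g i = coeff q n - coeff q (k - 2) * coeff q (Suc n)"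
        by (simp add: g_def n coeff_pCons)
      have q_high: "coeff q l = 0" if "l > k - 1" for l using that dq by (intro coeff_eq_0) simp
      consider "n = k - 2" "Suc n = k - 1" | "Suc n = k" | "n > k - 1" using n(2) k1 by linarith
      then show ?thesis
      proof cases
        case 1
        then show ?thesis using gi lq n(1) k1 by simp
      next
        case 2
        then have "n = k - 1" by simp
        then show ?thesis using gi lq n(1) q_high[of "Suc n"] 2 by simp
      next
        case 3
        then show ?thesis using gi n(1) q_high[of n] q_high[of "Suc n"] by simp
      qed
    qed
    have g0: "riesz ?\<gamma> (g * monom 1 j) = 0" if "j \<le> k" for j
    proof -
      have "degree g \<le> k"
        unfolding g_def using degree_mult_le[of "[:- coeff q (k - 2), 1:]" q] dq k by simp
      then have "degree (g * monom 1 j) \<le> 2 * k"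
        using degree_mult_le[of g "monom 1 j"] degree_monom_le[of "1 :: real" j] that by linarith
      then show ?thesis using kill[of "[:- coeff q (k - 2), 1:] * m" "monom 1 j"]
        unfolding g_def q_def by (simp only: mult.assoc)
    qed
    let ?f = "monom 1 k - g"
    show df: "degree ?f \<le> k - 2" by (intro degree_le) (auto simp: g)
    \<comment> \<open>For \<open>j = k - 1\<close> the index \<open>k + j\<close> would be the
      position of the free moment.\<close>
    have *: "riesz \<beta> (?f * monom 1 j) = \<beta> (k + j)" if "j \<le> k" "j \<noteq> k - 1" for j
    proof -
      have "degree (?f * monom 1 j) < 2 * k - 1"
        using degree_mult_le[of ?f "monom 1 j"] degree_monom_le[of "1 :: real" j] df that k1 by linarith
      then have "riesz \<beta> (?f * monom 1 j) = riesz ?\<gamma> (?f * monom 1 j)" by (simp add: riesz_completed_low)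
      also have "\<dots> = ?\<gamma> (k + j)" using g0[of j] that by (simp add: left_diff_distrib mult_monom)
      also have "\<dots> = \<beta> (k + j)"
      proof -
        have "k + j \<noteq> 2 * k - 1" using that k1 by linarith
        then show ?thesis by (simp add: completed_def)
      qed
      finally show ?thesis .
    qed
    show "riesz \<beta> (?f * monom 1 j) = \<beta> (k + j)" if "j \<le> k - 2" for j
      using that k1 by (intro *) auto
    show "riesz \<beta> (?f * monom 1 k) = \<beta> (2 * k)"
      using *[of k] k1 by (simp add: mult_2)
  qed
  with rank1 show "mat_rank (hankel (k - 2) \<beta>) = mat_rank (hankel (k - 1) \<beta>) \<and>
      mat_rank (hankel (k - 1) \<beta>) = mat_rank (A_tilde k \<beta>)" by simp
qed

section \<open>Sufficiency of the conditions\<close>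

lemma pd_imp_atomic_representing_measure:
  assumes k: "k \<ge> 1" and psd: "partially_psd (hankel k (unspecified k \<beta>))"
    and pd: "pd (hankel (k - 1) \<beta>)"
  shows "\<exists>x \<mu>. representing_measure k (completed k \<beta> x) \<mu> \<and> atomic (seq_rank (k - 1) \<beta>) \<mu>"
proof -
  have pos: "0 < riesz \<beta> (q * q)" if "q \<noteq> 0" "degree q < k" for q
    using pd that by (simp add: pd_hankel_iff)
  obtain x p where p: "degree p = k" "\<And>j. j \<le> k \<Longrightarrow> riesz (completed k \<beta> x) (p * monom 1 j) = 0"
    using flat_completion[OF k pos] psd unfolding partially_psd_unspecified_iff[OF k] by metis
  have pos': "0 < riesz (completed k \<beta> x) (q * q)" if "q \<noteq> 0" "degree q < degree p" for q
    using riesz_completed_square[OF k, of q \<beta> x] pos[of q] that p(1) coeff_eq_0[of q k] by simp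
  have p0: "p \<noteq> 0" and dp: "degree p \<le> k + 1" using p(1) k by auto
  \<comment> \<open>Orthogonality to the powers up to \<open>k\<close> makes the quadrature at the
    \<open>k\<close> roots exact up to degree \<open>2 k\<close>, which covers all moments.\<close>
  obtain S w where S: "finite S" "card S = degree p" "\<And>a. a \<in> S \<Longrightarrow> 0 < w a"
    and quad: "\<And>f. degree f \<le> degree p + k \<Longrightarrow> riesz (completed k \<beta> x) f = (\<Sum>a\<in>S. w a * poly f a)"
    by (rule gauss_quadrature[OF pos' p0 p(2) dp]) auto
  have "completed k \<beta> x i = (\<Sum>a\<in>S. w a * a ^ i)" if "i \<le> 2 * k" for i
    using quad[of "monom 1 i"] degree_monom_le[of "1 :: real" i] that p(1) by (simp add: poly_monom)
  then show ?thesis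
    using ex_atomic_representing_measure[OF S(1), of w k "completed k \<beta> x"] S(2,3) p(1) seq_rank_pd[OF pd] k by auto
qed

text \<open>The quadrature of the singular sequence reproduces the moments up to \<open>s + k - 1\<close> only. The rank
  conditions yield monic polynomials of degree \<open>k - 1\<close> and \<open>k\<close> that vanish on the atoms, and the
  resulting recursions carry the agreement on to the indices \<open>2 k - 2\<close> and \<open>2 k\<close>.\<close>

lemma rank_conditions_imp_atomic_representing_measure:
  assumes k: "k > 1" and psd: "psd (hankel (k - 1) \<beta>)" and npd: "\<not> pd (hankel (k - 1) \<beta>)"
    and rank1: "mat_rank (hankel (k - 2) \<beta>) = mat_rank (hankel (k - 1) \<beta>)"
    and rank2: "mat_rank (hankel (k - 2) \<beta>) = mat_rank (A_tilde k \<beta>)"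
  shows "\<exists>x \<mu>. representing_measure k (completed k \<beta> x) \<mu> \<and> atomic (seq_rank (k - 1) \<beta>) \<mu>"
proof -
  obtain p where p: "degree p = seq_rank (k - 1) \<beta>" "degree p \<le> k - 1" "p \<noteq> 0"
      "\<And>j. j \<le> k - 1 \<Longrightarrow> riesz \<beta> (p * monom 1 j) = 0"
    and pos: "\<And>q. q \<noteq> 0 \<Longrightarrow> degree q < degree p \<Longrightarrow> 0 < riesz \<beta> (q * q)"
    using seq_rank_psd_singular[OF psd npd] by metis
  obtain S w where S: "finite S" "card S = degree p" "\<And>a. a \<in> S \<Longrightarrow> 0 < w a"
    and quad: "\<And>f. degree f \<le> degree p + (k - 1) \<Longrightarrow> riesz \<beta> f = (\<Sum>a\<in>S. w a * poly f a)"
    by (rule gauss_quadrature[OF pos p(3,4)]) (use p(2) in auto)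
  \<comment> \<open>Here \<open>\<mu>\<close> is the moment sequence of the atoms, defined at every
    index.\<close>
  define \<mu> where "\<mu> i = (\<Sum>a\<in>S. w a * a ^ i)" for i
  have riesz_\<mu>: "riesz \<mu> f = (\<Sum>a\<in>S. w a * poly f a)" for f
    unfolding riesz_def \<mu>_def poly_altdef sum_distrib_left
    by (subst sum.swap) (simp add: mult_ac)
  have low: "riesz \<mu> f = riesz \<beta> f" if "degree f \<le> degree p + (k - 1)" for f
    using quad[OF that] riesz_\<mu> by simp
  \<comment> \<open>The Lagrange polynomials have degree below \<open>degree p\<close>, and testing
    \<open>g\<close> against them isolates each atom. So \<open>g\<close> vanishes at all
    atoms.\<close>
  have vanish: "riesz \<mu> (g * f) = 0"
    if g: "\<And>j. j < degree p \<Longrightarrow> riesz \<mu> (g * monom 1 j) = 0" for g f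
  proof -
    have "poly g a = 0" if a: "a \<in> S" for a
    proof -
      let ?l = "lagrange_poly S a"
      have "riesz \<mu> (g * ?l) = 0"
        unfolding riesz_mult[of ?l "degree ?l", OF order_refl]
        using degree_lagrange_poly[OF S(1) a] S(2) g by (intro sum.neutral) auto
      moreover have "riesz \<mu> (g * ?l) = (\<Sum>b\<in>S. if b = a then w b * poly g b else 0)"
        unfolding riesz_\<mu> using poly_lagrange_poly[OF S(1) a] by (intro sum.cong) auto
      ultimately show ?thesis using S(1) S(3)[OF a] a by simp
    qed
    then show ?thesis by (simp add: riesz_\<mu>)
  qed
  obtain f1 where f1: "degree f1 \<le> k - 2" "\<And>j. j \<le> k - 1 \<Longrightarrow> riesz \<beta> (f1 * monom 1 j) = \<beta> (k - 1 + j)"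
  proof -
    obtain f where f: "degree f \<le> k - 2" "\<And>j. j \<le> k - 2 \<Longrightarrow> riesz \<beta> (f * monom 1 j) = \<beta> (k - 1 + j)"
      "riesz \<beta> (f * monom 1 (k - 1)) = \<beta> (2 * (k - 1))"
      using rank1 unfolding rank_conditions_iff(1)[OF k] by blast
    have "riesz \<beta> (f * monom 1 j) = \<beta> (k - 1 + j)" if "j \<le> k - 1" for j
      using f(2)[of j] f(3) that by (cases "j = k - 1") (auto simp: mult_2)
    then show thesis using that f(1) by blast
  qed
  obtain f2 where f2: "degree f2 \<le> k - 2" "\<And>j. j \<le> k - 2 \<Longrightarrow> riesz \<beta> (f2 * monom 1 j) = \<beta> (k + j)"
      "riesz \<beta> (f2 * monom 1 k) = \<beta> (2 * k)"
    using rank2 unfolding rank_conditions_iff(2)[OF k] by blast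
  \<comment> \<open>The low moments agree with \<open>\<beta>\<close>, hence
    \<open>t^(k - 1) - f1\<close> vanishes on the atoms, which gives a recursion for
    \<open>\<mu>\<close> at every index.\<close>
  have rec1: "riesz \<mu> (f1 * monom 1 j) = \<mu> (k - 1 + j)" for j
  proof -
    let ?q = "monom 1 (k - 1) - f1"
    have "riesz \<mu> (?q * monom 1 i) = 0" if i: "i < degree p" for i
    proof -
      have "degree (f1 * monom 1 i) \<le> degree p + (k - 1)" "degree (monom (1 :: real) (k - 1 + i)) \<le> degree p + (k - 1)"
        using degree_mult_le[of f1 "monom 1 i"] degree_monom_le[of "1 :: real" i]
          degree_monom_le[of "1 :: real" "k - 1 + i"] f1(1) i by linarith+
      then show ?thesis
        using f1(2)[of i] i p(2) low[of "f1 * monom 1 i"] low[of "monom 1 (k - 1 + i)"]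
        by (simp add: left_diff_distrib mult_monom)
    qed
    from vanish[OF this, of "monom 1 j"] show ?thesis by (simp add: left_diff_distrib mult_monom)
  qed
  \<comment> \<open>Both sequences obey the recursion through \<open>f1\<close>, which expresses the
    moment of index \<open>k - 1 + j\<close> by moments of smaller index.\<close>
  have agree: "i \<le> 2 * k - 2 \<Longrightarrow> \<mu> i = \<beta> i" for i
  proof (induction i rule: less_induct)
    case (less i)
    show ?case
    proof (cases "i \<le> k - 1")
      case True
      then have "degree (monom (1 :: real) i) \<le> degree p + (k - 1)"
        using degree_monom_le[of "1 :: real" i] by linarith
      then show ?thesis using low[of "monom 1 i"] by simp
    next
      case False
      define j where "j = i - (k - 1)"
      have j: "i = k - 1 + j" "j \<le> k - 1" using False less.prems by (auto simp: j_def)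
      have "degree (f1 * monom 1 j) \<le> k - 2 + j"
        using degree_mult_le[of f1 "monom 1 j"] degree_monom_le[of "1 :: real" j] f1(1) by linarith
      then have "riesz \<mu> (f1 * monom 1 j) = riesz \<beta> (f1 * monom 1 j)"
        using less j k by (intro riesz_cong) auto
      then show ?thesis using rec1[of j] f1(2)[OF j(2)] j(1) by simp
    qed
  qed
  have eq: "riesz \<mu> f = riesz \<beta> f" if "degree f \<le> 2 * k - 2" for f
    using agree that by (intro riesz_cong) auto
  have deg_f2: "degree (f2 * monom 1 j) \<le> 2 * k - 2" if "j \<le> k" for j
    using degree_mult_le[of f2 "monom 1 j"] degree_monom_le[of "1 :: real" j] f2(1) that k by linarith
  \<comment> \<open>As \<open>i < degree p \<le> k - 1\<close>, only indices up to
    \<open>2 k - 2\<close> occur. So \<open>t^k - f2\<close> vanishes on the atoms too, and its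
    product with \<open>t^k\<close> reaches the index \<open>2 k\<close>.\<close>
  have "riesz \<mu> ((monom 1 k - f2) * monom 1 i) = 0" if i: "i < degree p" for i
    using f2(2)[of i] i p(2) eq[OF deg_f2, of i] agree[of "k + i"] k
    by (simp add: left_diff_distrib mult_monom)
  from vanish[OF this, of "monom 1 k"] have "\<mu> (2 * k) = \<beta> (2 * k)"
    using eq[OF deg_f2, of k] f2(3) by (simp add: left_diff_distrib mult_monom mult_2)
  \<comment> \<open>The free moment is taken from the atoms.\<close>
  then have "completed k \<beta> (\<mu> (2 * k - 1)) i = (\<Sum>a\<in>S. w a * a ^ i)" if "i \<le> 2 * k" for i
    unfolding \<mu>_def[symmetric] using that agree[of i] k
    by (cases "i = 2 * k"; cases "i = 2 * k - 1") (auto simp: completed_def)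
  then show ?thesis
    using ex_atomic_representing_measure[OF S(1), of w k "completed k \<beta> (\<mu> (2 * k - 1))"] S(2,3) p(1) by auto
qed

theorem theorem3p1:
  fixes k :: nat and \<beta> :: "nat \<Rightarrow> real"
  assumes "k \<ge> 1" and "\<beta> 0 > 0"
  defines "S1 \<equiv> (\<exists>x\<^sub>0 \<mu>. representing_measure k (completed k \<beta> x\<^sub>0) \<mu>)"
    and "S2 \<equiv> (\<exists>x\<^sub>0 \<mu>. representing_measure k (completed k \<beta> x\<^sub>0) \<mu> \<and> atomic (seq_rank (k - 1) \<beta>) \<mu>)"
    and "S3 \<equiv> (partially_psd (hankel k (unspecified k \<beta>)) \<and>
          (k = 1 \<or>
           k > 1 \<and>
             (pd (hankel (k - 1) \<beta>) \<or>
              mat_rank (hankel (k - 2) \<beta>) = mat_rank (hankel (k - 1) \<beta>) \<and>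
              mat_rank (hankel (k - 1) \<beta>) = mat_rank (A_tilde k \<beta>))))"
  shows "(S1 \<longleftrightarrow> S2) \<and> (S2 \<longleftrightarrow> S3)"
proof -
  have "S2 \<Longrightarrow> S1" unfolding S1_def S2_def by blast
  moreover have "S1 \<Longrightarrow> S3"
    unfolding S1_def S3_def using representing_measure_imp_conditions[OF assms(1)] assms(1)
    by (metis le_neq_implies_less)
  moreover have "S2" if S3
  proof -
    have psd: "partially_psd (hankel k (unspecified k \<beta>))" using that by (simp add: S3_def)
    show ?thesis
    proof (cases "pd (hankel (k - 1) \<beta>)")
      case True
      then show ?thesis
        unfolding S2_def by (rule pd_imp_atomic_representing_measure[OF assms(1) psd])
    next
      case False
      \<comment> \<open>For \<open>k = 1\<close> the matrix has the single entry
        \<open>\<beta> 0 > 0\<close> and is positive definite.\<close>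
      have "k \<noteq> 1"
      proof
        assume "k = 1"
        have "0 < riesz \<beta> (p * p)" if p: "p \<noteq> 0" "degree p = 0" for p
        proof -
          obtain a where a: "p = [:a:]" using degree_eq_zeroE[OF p(2)] .
          then have "0 < a * a" using p(1) by (metis not_real_square_gt_zero pCons_0_0)
          then have "0 < a * a * \<beta> 0" using assms(2) by (rule mult_pos_pos)
          then show ?thesis using a by (simp add: riesz_def)
        qed
        then show False using False \<open>k = 1\<close> by (simp add: pd_hankel_iff)
      qed
      then have k: "k > 1" using assms(1) by simp
      \<comment> \<open>Polynomials of degree at most \<open>k - 1\<close> have no term
        \<open>t^k\<close>, so the partial condition covers them.\<close>
      have "psd (hankel (k - 1) \<beta>)"
        unfolding psd_hankel_iff
      proof (intro allI impI)
        fix p :: "real poly" assume "degree p \<le> k - 1"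
        then have "degree p \<le> k" "coeff p k = 0" using k by (auto intro: coeff_eq_0)
        then show "0 \<le> riesz \<beta> (p * p)"
          using psd unfolding partially_psd_unspecified_iff[OF assms(1)] by blast
      qed
      then show ?thesis
        unfolding S2_def using that False k
        by (intro rank_conditions_imp_atomic_representing_measure) (auto simp: S3_def)
    qed
  qed
  ultimately show ?thesis by blast
qed

end
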